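(* Let $d=(d_1,\ldots,d_n)$ be a non-increasing sequence of positive integers and let $\gamma\in[1,n]$. Then $d$ has a realization with a dominating set of size $\gamma$ if and only if all of the following constraints hold: (1) for every $k\in[0,n-\gamma]$: $\sum_{i=\gamma+1}^{\gamma+k}(d_i-1)\le k(k-1)-(n-\gamma)+\sum_{i=1}^{\gamma}d_i+\sum_{i=\gamma+k+1}^{n}\min\{k,d_i-1\}$; (2) for every $k\in[0,n]$: $\sum_{i=1}^{k}d_i\le k(k-1)+\sum_{i=k+1}^{n}\min\{k,d_i\}$; (3) for every $k\in[0,d_1]$: $\sum_{i=\gamma+1}^{\gamma+k}d_i\le k(k-1)+\sum_{i=1}^{\gamma}\min\{k,d_i\}+\sum_{i=\gamma+k+1}^{n}\min\{k,d_i-1\}$.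
   Context: A (simple, undirected) graph $G$ on vertices $1,\ldots,n$ realizes $d$ if $\deg_G(i)=d_i$ for all $i$. A dominating set of $G$ is a set $D$ of vertices such that every vertex not in $D$ has a neighbour in $D$. $[a,b]=\{a,a+1,\ldots,b\}$.
   Formalization: The condition that the sum of the d_i is even is added to constraints (1)–(3); without it the claim fails, e.g. d=(1,1,1), γ=2 satisfies (1)–(3) but has odd sum and so no realization. In (3), sums running past n are cut off at n. *)

theory Defs
  imports Main
begin

(* Edges are two-element sets of vertices: no loops, no multiple edges, no orientation. *)
definition simple_graph :: "'v set \<Rightarrow> 'v set set \<Rightarrow> bool" where
  "simple_graph V E \<longleftrightarrow> finite V \<and> (\<forall>e\<in>E. e \<subseteq> V \<and> card e = 2)"

definition neighbours :: "'v set set \<Rightarrow> 'v \<Rightarrow> 'v set" where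
  "neighbours E v = {u. {u, v} \<in> E}"

definition degree :: "'v set set \<Rightarrow> 'v \<Rightarrow> nat" where
  "degree E v = card (neighbours E v)"

(* Sequences d_1, ..., d_n are functions on nat of which only the values at 1, ..., n matter. *)
definition realizes :: "nat \<Rightarrow> nat set set \<Rightarrow> (nat \<Rightarrow> nat) \<Rightarrow> bool" where
  "realizes n E d \<longleftrightarrow> simple_graph {1..n} E \<and> (\<forall>i\<in>{1..n}. degree E i = d i)"

definition dominating_set :: "'v set \<Rightarrow> 'v set set \<Rightarrow> 'v set \<Rightarrow> bool" where
  "dominating_set V E D \<longleftrightarrow> D \<subseteq> V \<and> (\<forall>v\<in>V - D. \<exists>u\<in>D. u \<in> neighbours E v)"

end

theory Submission
  imports Defs
begin

text \<open>
  Write \<open>D = {1..\<gamma>}\<close> and \<open>W = {\<gamma>+1..n}\<close>. A dominating set can be moved to \<open>D\<close> by exchanging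
  neighbours of two vertices, after which all three conditions are double counts of edges.

  For the converse, condition (2) is the Erdos-Gallai condition and yields a realization; take one
  with as few vertices of \<open>W\<close> as possible undominated by \<open>D\<close>. Condition (1) is an Erdos-Gallai
  condition with deficiency on \<open>W\<close>: there is a graph on \<open>W\<close> with degrees at most \<open>d - 1\<close> and enough
  edges, and augmenting towards it along alternating trails removes any pair of undominated
  vertices that each lack one edge. Among all edges \<open>wx\<close> with \<open>w\<close> undominated, in all
  optimal realizations, choose one whose end \<open>x = r\<close> is the largest. Switching arguments then show
  that \<open>S = {\<gamma>+1..r}\<close> is a clique and that every other vertex is adjacent to all of \<open>S\<close> or, apart
  from one dominator of a vertex in \<open>W\<close>, only to \<open>S\<close>. Counting the edges at \<open>S\<close>, with \<open>w\<close> giving a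
  strict inequality, contradicts condition (3) for \<open>k = r - \<gamma>\<close>.
\<close>

section \<open>Degrees and switches\<close>

text \<open>The pivot is a fact about any neighbour \<open>x\<close> of an undominated
  \<open>w\<close> in an optimal realization: \<open>x\<close> has at least two dominators. If it
  had fewer, deleting \<open>wx\<close>, after passing a sole dominator of \<open>x\<close> on to
  \<open>w\<close>, would leave a graph that lacks two units of degree at undominated vertices, and
  (1) allows such a graph to be completed without spoiling domination. On the other hand, a
  non-neighbour of \<open>x\<close> has at most one neighbour in \<open>D\<close>, since otherwise a
  switch would give \<open>w\<close> a dominator for free. Once every vertex of \<open>S\<close> can
  play the part of \<open>x\<close>, these two bounds clash for nonadjacent members of
  \<open>S\<close>. The end \<open>r\<close> is taken largest for two reasons. Vertices of
  \<open>W\<close> before \<open>r\<close> have degree at least \<open>d r\<close>, so they can take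
  its place; and a switch that creates a new far end of such an edge must put it into
  \<open>S\<close>. The \<open>d - 1\<close> in (1) and (3) accounts for the edge that a vertex of
  \<open>W\<close> spends on a dominator. The vertex \<open>w\<close> spends none, which is the
  source of strictness.\<close>

lemma mem_neighbours: "u \<in> neighbours E v \<longleftrightarrow> {u, v} \<in> E"
  by (simp add: neighbours_def)

lemma neighbours_sym: "u \<in> neighbours E v \<longleftrightarrow> v \<in> neighbours E u"
  by (simp add: neighbours_def insert_commute)

context
  fixes V :: "'v set" and E :: "'v set set"
  assumes sg: "simple_graph V E"
begin

lemma edge_in:
  assumes "{u, v} \<in> E"
  shows "u \<in> V" "v \<in> V" "u \<noteq> v"
  using assms sg unfolding simple_graph_def by (force simp: card_insert_if split: if_splits)+

lemma neighbours_sub: "neighbours E v \<subseteq> V - {v}"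
  unfolding neighbours_def using edge_in(1,3) by blast

lemma finite_vertices: "finite V"
  using sg by (simp add: simple_graph_def)

lemma finite_neighbours: "finite (neighbours E v)"
  using neighbours_sub finite_vertices finite_subset by blast

lemma finite_edges: "finite E"
  using sg unfolding simple_graph_def by (meson PowI finite_Pow_iff finite_subset subsetI)

lemma simple_graph_insert:
  assumes "u \<in> V" "v \<in> V" "u \<noteq> v"
  shows "simple_graph V (insert {u, v} E)"
  using assms sg by (auto simp: simple_graph_def)

lemma simple_graph_subset: "F \<subseteq> E \<Longrightarrow> simple_graph V F"
  using sg by (auto simp: simple_graph_def)

lemma simple_graph_diff: "simple_graph V (E - F)"
  by (rule simple_graph_subset) auto

lemma degree_insert:
  assumes "u \<noteq> v" "{u, v} \<notin> E"
  shows "degree (insert {u, v} E) x = degree E x + of_bool (x = u) + of_bool (x = v)"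
proof -
  have "neighbours (insert {u, v} E) x =
      (if x = u then insert v (neighbours E x) else if x = v then insert u (neighbours E x)
       else neighbours E x)"
    using assms(1) by (auto simp: neighbours_def doubleton_eq_iff)
  then show ?thesis
    using assms finite_neighbours by (auto simp: degree_def mem_neighbours insert_commute)
qed

end

lemma degree_remove:
  assumes sg: "simple_graph V E" and e: "{u, v} \<in> E"
  shows "degree E x = degree (E - {{u, v}}) x + of_bool (x = u) + of_bool (x = v)"
proof -
  have "insert {u, v} (E - {{u, v}}) = E" using e by auto
  with degree_insert[OF simple_graph_diff[OF sg], of u v "{{u, v}}" x] edge_in[OF sg e]
  show ?thesis by simp
qed

lemma sum_degree_eq:
  assumes sg: "simple_graph V E" and "K \<subseteq> V" "A \<subseteq> V"
  shows "(\<Sum>v\<in>K. card (neighbours E v \<inter> A)) = (\<Sum>v\<in>A. card (neighbours E v \<inter> K))"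
proof -
  have fin: "finite K" "finite A" using assms finite_vertices[OF sg] finite_subset by auto
  have *: "card (neighbours E v \<inter> B) = (\<Sum>u\<in>B. of_bool ({u, v} \<in> E))" if "finite B" for v B
  proof -
    have "neighbours E v \<inter> B = {u \<in> B. {u, v} \<in> E}" by (auto simp: neighbours_def)
    with that show ?thesis by (simp add: sum.If_cases of_bool_def Int_def)
  qed
  have "(\<Sum>v\<in>K. card (neighbours E v \<inter> A)) = (\<Sum>v\<in>K. \<Sum>u\<in>A. of_bool ({u, v} \<in> E))"
    by (simp add: * fin)
  also have "\<dots> = (\<Sum>u\<in>A. \<Sum>v\<in>K. of_bool ({u, v} \<in> E))" by (rule sum.swap)
  also have "\<dots> = (\<Sum>v\<in>A. card (neighbours E v \<inter> K))"
    by (simp add: * fin insert_commute)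
  finally show ?thesis .
qed

lemma sum_degree_eq_V:
  assumes sg: "simple_graph V E" and "K \<subseteq> V"
  shows "(\<Sum>v\<in>K. degree E v) = (\<Sum>v\<in>V. card (neighbours E v \<inter> K))"
proof -
  have "neighbours E v \<inter> V = neighbours E v" for v using neighbours_sub[OF sg] by blast
  with sum_degree_eq[OF assms order_refl] show ?thesis by (simp add: degree_def)
qed

lemma even_sum_degree:
  assumes "simple_graph V E"
  shows "even (\<Sum>v\<in>V. degree E v)"
proof -
  have "simple_graph V F \<longrightarrow> even (\<Sum>v\<in>V. degree F v)" if "finite F" for F :: "'a set set"
    using that
  proof (induction F rule: finite_induct)
    case empty
    show ?case by (simp add: degree_def neighbours_def)
  next
    case (insert e F)
    show ?case
    proof
      assume sg: "simple_graph V (insert e F)"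
      then have sF: "simple_graph V F" by (rule simple_graph_subset) auto
      obtain u v where e: "e = {u, v}" "u \<noteq> v"
        using sg by (auto simp: simple_graph_def card_2_iff)
      have "u \<in> V" "v \<in> V" using sg e by (auto simp: simple_graph_def)
      then have "(\<Sum>x\<in>V. degree (insert e F) x) = (\<Sum>x\<in>V. degree F x) + 2"
        using degree_insert[OF sF e(2)] insert.hyps e finite_vertices[OF sF]
        by (simp add: sum.distrib of_bool_def)
      with insert.IH sF show "even (\<Sum>x\<in>V. degree (insert e F) x)" by simp
    qed
  qed
  with assms finite_edges[OF assms] show ?thesis by blast
qed

section \<open>Degree-preserving switches along alternating 4-cycles\<close>

definition switch :: "'v set set \<Rightarrow> 'v \<Rightarrow> 'v \<Rightarrow> 'v \<Rightarrow> 'v \<Rightarrow> 'v set set" where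
  "switch E a b c e = insert {a, c} (insert {b, e} (E - {{a, b}} - {{c, e}}))"

lemma mem_switch:
  "{p, q} \<in> switch E a b c e \<longleftrightarrow> {p, q} = {a, c} \<or> {p, q} = {b, e} \<or>
     {p, q} \<in> E \<and> {p, q} \<noteq> {a, b} \<and> {p, q} \<noteq> {c, e}"
  by (auto simp: switch_def)

context
  fixes V :: "'v set" and E :: "'v set set" and a b c e :: 'v
  assumes sg: "simple_graph V E"
    and ab: "{a, b} \<in> E" and ce: "{c, e} \<in> E"
    and ac: "{a, c} \<notin> E" and be: "{b, e} \<notin> E" and ne: "a \<noteq> c" "b \<noteq> e"
begin

lemma simple_graph_switch: "simple_graph V (switch E a b c e)"
  unfolding switch_def
  using edge_in[OF sg ab] edge_in[OF sg ce] ne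
  by (intro simple_graph_insert simple_graph_diff sg) auto

lemma degree_switch: "degree (switch E a b c e) x = degree E x"
proof -
  have neq: "{a, b} \<noteq> {c, e}" "{a, c} \<noteq> {b, e}"
    using ab ac edge_in[OF sg ab] ne by (auto simp: doubleton_eq_iff insert_commute)
  let ?E1 = "E - {{a, b}}" let ?E2 = "?E1 - {{c, e}}" let ?E3 = "insert {b, e} ?E2"
  have s1: "simple_graph V ?E1" and s2: "simple_graph V ?E2"
    using sg simple_graph_diff by blast+
  have s3: "simple_graph V ?E3"
    using edge_in[OF sg ab] edge_in[OF sg ce] ne by (intro simple_graph_insert s2) auto
  have "degree E x = degree ?E1 x + of_bool (x = a) + of_bool (x = b)"
    by (rule degree_remove[OF sg ab])
  moreover have "degree ?E1 x = degree ?E2 x + of_bool (x = c) + of_bool (x = e)"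
    by (rule degree_remove[OF s1]) (use ce neq in auto)
  moreover have "degree ?E3 x = degree ?E2 x + of_bool (x = b) + of_bool (x = e)"
    by (rule degree_insert[OF s2]) (use be ne in auto)
  moreover have "degree (insert {a, c} ?E3) x = degree ?E3 x + of_bool (x = a) + of_bool (x = c)"
    by (rule degree_insert[OF s3]) (use ac ne neq in auto)
  ultimately show ?thesis by (simp add: switch_def)
qed

end


text \<open>The neighbour sought must differ from \<open>r\<close> and \<open>i\<close>. Adjacency
  is symmetric and \<open>i\<close>, \<open>r\<close> lie on the same side of \<open>A\<close>, so
  removing \<open>r\<close> from one set and \<open>i\<close> from the other costs both the same and
  the strict inequality survives.\<close>

lemma ex_neighbour_diff:
  assumes sg: "simple_graph V E"
    and lt: "card (neighbours E r \<inter> A) < card (neighbours E i \<inter> A)"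
    and iff: "i \<in> A \<longleftrightarrow> r \<in> A"
  obtains u where "u \<in> A" "{u, i} \<in> E" "{u, r} \<notin> E" "u \<noteq> r" "u \<noteq> i"
proof -
  let ?I = "neighbours E i \<inter> A" and ?R = "neighbours E r \<inter> A"
  have fin: "finite ?I" "finite ?R" using finite_neighbours[OF sg] by auto
  have "card (?R - {i}) < card (?I - {r})"
    using lt fin iff neighbours_sym[of r E i]
    by (auto simp: card_Diff_singleton_if intro!: diff_less_mono Suc_leI card_gt_0_iff[THEN iffD2])
  then obtain u where "u \<in> ?I - {r}" "u \<notin> ?R - {i}"
    using fin by (meson card_mono finite_Diff not_le subsetI)
  then show ?thesis
    using that[of u] edge_in(3)[OF sg, of u i] by (auto simp: mem_neighbours)
qed

lemma ex_neighbour_diff_degree: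
  assumes sg: "simple_graph V E" and lt: "degree E r < degree E i"
  obtains u where "{u, i} \<in> E" "{u, r} \<notin> E" "u \<noteq> r" "u \<noteq> i"
  using ex_neighbour_diff[OF sg, of r UNIV i] lt by (auto simp: degree_def)

section \<open>The Erdos-Gallai theorem\<close>

text \<open>
  The proof of Tripathi, Venugopalan and West: the vertices are saturated in increasing order,
  keeping the vertices beyond the current one independent. If no step is possible at \<open>r\<close>, then
  \<open>{a+1..r}\<close> violates the Erdos-Gallai inequality.
\<close>

definition saturates :: "nat \<Rightarrow> nat \<Rightarrow> (nat \<Rightarrow> nat) \<Rightarrow> nat \<Rightarrow> nat set set \<Rightarrow> bool" where
  "saturates a n c r E \<longleftrightarrow> simple_graph {a+1..n} E \<and>
     (\<forall>v\<in>{a+1..n}. degree E v \<le> c v) \<and> (\<forall>v\<in>{a+1..n}. v < r \<longrightarrow> degree E v = c v) \<and>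
     (\<forall>u v. {u, v} \<in> E \<longrightarrow> u \<le> r \<or> v \<le> r)"

text \<open>If no step is possible, the exchanges \<open>adj0\<close> to \<open>adj3\<close> make
  \<open>{a+1..r}\<close> a clique and join every unsaturated later vertex to all of it. Saturated
  later vertices have all their edges into it because the vertices beyond \<open>r\<close> are
  independent. Hence the degree sum over \<open>{a+1..r}\<close> reaches the right side of
  \<open>EG\<close>, yet it is below the left side because of \<open>r\<close>.\<close>

lemma saturates_step:
  fixes a n r :: nat and c :: "nat \<Rightarrow> nat"
  assumes noninc: "\<And>i j. a < i \<Longrightarrow> i \<le> j \<Longrightarrow> j \<le> n \<Longrightarrow> c j \<le> c i"
    and even: "even (\<Sum>i=a+1..n. c i)"
    and EG: "(\<Sum>i=a+1..r. c i) \<le> (r - a) * (r - a - 1) + (\<Sum>i=r+1..n. min (r - a) (c i))"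
    and r: "a < r" "r \<le> n"
    and sat: "saturates a n c r E" and hungry: "degree E r < c r"
  shows "\<exists>E'. saturates a n c r E' \<and> degree E r < degree E' r"
proof (rule ccontr)
  let ?V = "{a+1..n}"
  assume no: "\<not> ?thesis"
  have sg: "simple_graph ?V E" and le: "\<And>v. v \<in> ?V \<Longrightarrow> degree E v \<le> c v"
    and full: "\<And>v. v \<in> ?V \<Longrightarrow> v < r \<Longrightarrow> degree E v = c v"
    and indep: "\<And>u v. {u, v} \<in> E \<Longrightarrow> u \<le> r \<or> v \<le> r"
    using sat by (auto simp: saturates_def)
  have rV: "r \<in> ?V" using r by auto
  have stuck: False if "simple_graph ?V E'" "\<And>v. v \<in> ?V \<Longrightarrow> v \<noteq> r \<Longrightarrow> v \<ge> r \<Longrightarrow> degree E' v \<le> c v"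
    "\<And>v. v \<in> ?V \<Longrightarrow> v < r \<Longrightarrow> degree E' v = degree E v"
    "degree E r < degree E' r" "degree E' r \<le> c r"
    "\<And>u v. {u, v} \<in> E' \<Longrightarrow> {u, v} \<in> E \<or> u \<le> r \<or> v \<le> r" for E'
  proof -
    have "saturates a n c r E'"
      unfolding saturates_def
      using that full indep by (metis le_less_linear nat_less_le order_refl)
    with no that(4) show False by blast
  qed
  note edge = edge_in[OF sg]
  have adj0: "{r, k} \<in> E" if k: "k \<in> ?V" "k > r" "degree E k < c k" for k
  proof (rule ccontr)
    assume nk: "{r, k} \<notin> E"
    have d: "degree (insert {r, k} E) v = degree E v + of_bool (v = r) + of_bool (v = k)" for v
      using degree_insert[OF sg _ nk] k by auto
    show False
    proof (rule stuck)
      show "simple_graph ?V (insert {r, k} E)"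
        by (rule simple_graph_insert[OF sg]) (use rV k in auto)
    qed (use d k hungry le in \<open>auto simp: of_bool_def doubleton_eq_iff\<close>)
  qed
  have bigger: "degree E r < degree E i" if "i \<in> ?V" "i < r" for i
    using noninc[of i r] full[OF that] that hungry r by auto
  have adj1: "{r, i} \<in> E" if i: "i \<in> ?V" "i < r" for i
  proof (rule ccontr)
    assume ni: "{r, i} \<notin> E"
    obtain u where u: "{u, i} \<in> E" "{u, r} \<notin> E" "u \<noteq> r" "u \<noteq> i"
      using ex_neighbour_diff_degree[OF sg bigger[OF i]] by blast
    define E1 where "E1 = E - {{u, i}}"
    have s1: "simple_graph ?V E1" unfolding E1_def by (rule simple_graph_diff[OF sg])
    have d1: "degree E v = degree E1 v + of_bool (v = u) + of_bool (v = i)" for v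
      unfolding E1_def by (rule degree_remove[OF sg u(1)])
    define E2 where "E2 = insert {u, r} E1"
    have s2: "simple_graph ?V E2" unfolding E2_def
      by (rule simple_graph_insert[OF s1]) (use u edge rV in auto)
    have d2: "degree E2 v = degree E1 v + of_bool (v = u) + of_bool (v = r)" for v
      unfolding E2_def by (rule degree_insert[OF s1]) (use u E1_def in auto)
    define E3 where "E3 = insert {r, i} E2"
    have ri2: "{r, i} \<notin> E2" using ni u i by (auto simp: E2_def E1_def doubleton_eq_iff)
    have s3: "simple_graph ?V E3" unfolding E3_def
      by (rule simple_graph_insert[OF s2]) (use i rV in auto)
    have d3: "degree E3 v = degree E2 v + of_bool (v = r) + of_bool (v = i)" for v
      unfolding E3_def by (rule degree_insert[OF s2]) (use ri2 i in auto)
    have d: "degree E3 v = degree E v + 2 * of_bool (v = r)" for v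
      using d1[of v] d2[of v] d3[of v] by auto
    have mem: "{x, y} \<in> E3 \<Longrightarrow> {x, y} \<in> E \<or> x \<le> r \<or> y \<le> r" for x y
      using i by (auto simp: E3_def E2_def E1_def doubleton_eq_iff)
    \<comment> \<open>\<open>E3\<close> raises \<open>r\<close> by two, which is one too many if
      \<open>r\<close> lacks a single edge. Parity then yields another deficient vertex
      \<open>k\<close>, necessarily beyond \<open>r\<close>; by \<open>adj0\<close> it is a
      neighbour of \<open>r\<close>, and deleting \<open>rk\<close> corrects the degree of
      \<open>r\<close>.\<close>
    show False
    proof (cases "degree E r + 2 \<le> c r")
      case True
      show False by (rule stuck[OF s3]) (use d le True mem in auto)
    next
      case False
      then have one: "c r = degree E r + 1" using hungry by auto
      have "\<exists>k\<in>?V. k > r \<and> degree E k < c k"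
      proof (rule ccontr)
        assume "\<not> ?thesis"
        then have "\<And>v. v \<in> ?V \<Longrightarrow> c v = degree E v + of_bool (v = r)"
          using le full one by (metis add.right_neutral nat_less_le not_less_iff_gr_or_eq of_bool_eq)
        then have "(\<Sum>v\<in>?V. c v) = (\<Sum>v\<in>?V. degree E v) + 1"
          using rV by (simp add: sum.distrib of_bool_def)
        with even even_sum_degree[OF sg] show False by simp
      qed
      then obtain k where k: "k \<in> ?V" "k > r" "degree E k < c k" by blast
      have rk: "{r, k} \<in> E" using adj0 k by blast
      have ku: "k \<noteq> u" using rk u by (auto simp: insert_commute)
      have rk3: "{r, k} \<in> E3" using rk ku k i u
        by (auto simp: E3_def E2_def E1_def doubleton_eq_iff)
      have d4: "degree E3 v = degree (E3 - {{r, k}}) v + of_bool (v = r) + of_bool (v = k)" for v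
        by (rule degree_remove[OF s3 rk3])
      have d5: "degree (E3 - {{r, k}}) v + of_bool (v = k) = degree E v + of_bool (v = r)" for v
        using d4[of v] d[of v] by auto
      show False
      proof (rule stuck[of "E3 - {{r, k}}"])
        show "degree E r < degree (E3 - {{r, k}}) r" "degree (E3 - {{r, k}}) r \<le> c r"
          using d5[of r] k one by auto
        show "degree (E3 - {{r, k}}) v = degree E v" if "v < r" for v
          using d5[of v] k that by auto
        show "degree (E3 - {{r, k}}) v \<le> c v" if "v \<in> ?V" "v \<noteq> r" for v
          using d5[of v] le[OF that(1)] that by auto
      qed (use mem simple_graph_diff[OF s3] in auto)
    qed
  qed
  have adj2: "{i, k} \<in> E" if k: "k \<in> ?V" "k > r" "degree E k < c k" and i: "i \<in> ?V" "i \<le> r" for i k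
  proof (rule ccontr)
    assume ik: "{i, k} \<notin> E"
    have i': "i < r" using ik i adj0[OF k] by (cases "i = r") auto
    obtain u where u: "{u, i} \<in> E" "{u, r} \<notin> E" "u \<noteq> r" "u \<noteq> i"
      using ex_neighbour_diff_degree[OF sg bigger[OF i(1) i']] by blast
    have uk: "u \<noteq> k" using u ik by (auto simp: insert_commute)
    define E1 where "E1 = E - {{u, i}}"
    have s1: "simple_graph ?V E1" unfolding E1_def by (rule simple_graph_diff[OF sg])
    have d1: "degree E v = degree E1 v + of_bool (v = u) + of_bool (v = i)" for v
      unfolding E1_def by (rule degree_remove[OF sg u(1)])
    define E2 where "E2 = insert {u, r} E1"
    have s2: "simple_graph ?V E2" unfolding E2_def
      by (rule simple_graph_insert[OF s1]) (use u edge rV in auto)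
    have d2: "degree E2 v = degree E1 v + of_bool (v = u) + of_bool (v = r)" for v
      unfolding E2_def by (rule degree_insert[OF s1]) (use u E1_def in auto)
    define E3 where "E3 = insert {i, k} E2"
    have ri2: "{i, k} \<notin> E2" using ik u i' k by (auto simp: E2_def E1_def doubleton_eq_iff)
    have s3: "simple_graph ?V E3" unfolding E3_def
      by (rule simple_graph_insert[OF s2]) (use i i' k in auto)
    have d3: "degree E3 v = degree E2 v + of_bool (v = i) + of_bool (v = k)" for v
      unfolding E3_def by (rule degree_insert[OF s2]) (use ri2 i' k in auto)
    have d: "degree E3 v = degree E v + of_bool (v = r) + of_bool (v = k)" for v
      using d1[of v] d2[of v] d3[of v] by auto
    show False
      by (rule stuck[OF s3])
        (use d k hungry le i' in \<open>auto simp: E3_def E2_def E1_def doubleton_eq_iff of_bool_def\<close>)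
  qed
  have adj3: "{i, j} \<in> E" if i: "i \<in> ?V" "i < r" and j: "j \<in> ?V" "j < r" and ij: "i \<noteq> j" for i j
  proof (rule ccontr)
    assume nij: "{i, j} \<notin> E"
    obtain u where u: "{u, i} \<in> E" "{u, r} \<notin> E" "u \<noteq> r" "u \<noteq> i"
      using ex_neighbour_diff_degree[OF sg bigger[OF i]] by blast
    obtain w where w: "{w, j} \<in> E" "{w, r} \<notin> E" "w \<noteq> r" "w \<noteq> j"
      using ex_neighbour_diff_degree[OF sg bigger[OF j]] by blast
    \<comment> \<open>The exchange takes one edge away from \<open>w\<close>. This is harmless
      beyond \<open>r\<close>, since only the vertices before \<open>r\<close> have to stay
      saturated.\<close>
    have wr: "w > r"
      using adj1[of w] w edge(1)[OF w(1)] by (metis insert_commute linorder_neqE_nat)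
    have uj: "u \<noteq> j" using u nij by (auto simp: insert_commute)
    define E1 where "E1 = E - {{u, i}}"
    have s1: "simple_graph ?V E1" unfolding E1_def by (rule simple_graph_diff[OF sg])
    have d1: "degree E v = degree E1 v + of_bool (v = u) + of_bool (v = i)" for v
      unfolding E1_def by (rule degree_remove[OF sg u(1)])
    define E2 where "E2 = insert {u, r} E1"
    have s2: "simple_graph ?V E2" unfolding E2_def
      by (rule simple_graph_insert[OF s1]) (use u edge rV in auto)
    have d2: "degree E2 v = degree E1 v + of_bool (v = u) + of_bool (v = r)" for v
      unfolding E2_def by (rule degree_insert[OF s1]) (use u E1_def in auto)
    define E3 where "E3 = insert {i, j} E2"
    have ri2: "{i, j} \<notin> E2" using nij u i j by (auto simp: E2_def E1_def doubleton_eq_iff)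
    have s3: "simple_graph ?V E3" unfolding E3_def
      by (rule simple_graph_insert[OF s2]) (use i j ij in auto)
    have d3: "degree E3 v = degree E2 v + of_bool (v = i) + of_bool (v = j)" for v
      unfolding E3_def by (rule degree_insert[OF s2]) (use ri2 ij in auto)
    have w3: "{w, j} \<in> E3"
      using w uj ij by (auto simp: E3_def E2_def E1_def doubleton_eq_iff)
    have d4: "degree E3 v = degree (E3 - {{w, j}}) v + of_bool (v = w) + of_bool (v = j)" for v
      by (rule degree_remove[OF s3 w3])
    have d: "degree (E3 - {{w, j}}) v + of_bool (v = w) = degree E v + of_bool (v = r)" for v
      using d1[of v] d2[of v] d3[of v] d4[of v] by auto
    show False
    proof (rule stuck[of "E3 - {{w, j}}"])
      show "degree E r < degree (E3 - {{w, j}}) r" "degree (E3 - {{w, j}}) r \<le> c r"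
        using d[of r] w hungry by auto
      show "degree (E3 - {{w, j}}) v = degree E v" if "v < r" for v
        using d[of v] wr that by auto
      show "degree (E3 - {{w, j}}) v \<le> c v" if "v \<in> ?V" "v \<noteq> r" for v
        using d[of v] le[OF that(1)] that by auto
    qed (use i simple_graph_diff[OF s3] in \<open>auto simp: E3_def E2_def E1_def doubleton_eq_iff\<close>)
  qed
  let ?K = "{a+1..r}" and ?T = "{r+1..n}"
  have K: "?K \<subseteq> ?V" and V: "?V = ?K \<union> ?T" "?K \<inter> ?T = {}" using r by auto
  have inK: "card (neighbours E v \<inter> ?K) = r - a - 1" if v: "v \<in> ?K" for v
  proof -
    have "{u, v} \<in> E" if "u \<in> ?K" "u \<noteq> v" for u
      using that v adj1[of u] adj1[of v] adj3[of u v] r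
      by (cases "u = r"; cases "v = r") (auto simp: insert_commute)
    then have "neighbours E v \<inter> ?K = ?K - {v}"
      using neighbours_sub[OF sg, of v] by (auto simp: mem_neighbours)
    then show ?thesis using v by simp
  qed
  have inT: "min (r - a) (c v) \<le> card (neighbours E v \<inter> ?K)" if v: "v \<in> ?T" for v
  proof (cases "degree E v = c v")
    case True
    have "neighbours E v \<inter> ?K = neighbours E v"
      using indep[of _ v] v edge by (fastforce simp: mem_neighbours)
    then show ?thesis using True by (simp add: degree_def)
  next
    case False
    then have "degree E v < c v" using le[of v] v r by auto
    then have "?K \<subseteq> neighbours E v" using adj2[of v] v r by (auto simp: mem_neighbours)
    then have "neighbours E v \<inter> ?K = ?K" by auto
    then show ?thesis by simp
  qed
  have "(\<Sum>v\<in>?K. degree E v) < (\<Sum>v\<in>?K. c v)"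
    using le K rV r hungry by (intro sum_strict_mono_ex1) auto
  also have "\<dots> \<le> (r - a) * (r - a - 1) + (\<Sum>v\<in>?T. min (r - a) (c v))" using EG by simp
  also have "\<dots> \<le> (\<Sum>v\<in>?K. card (neighbours E v \<inter> ?K)) + (\<Sum>v\<in>?T. card (neighbours E v \<inter> ?K))"
    using inT inK by (intro add_mono sum_mono) auto
  also have "\<dots> = (\<Sum>v\<in>?K. degree E v)"
    using sum_degree_eq_V[OF sg K] V by (simp add: sum.union_disjoint)
  finally show False by simp
qed

text \<open>The offset \<open>a\<close> serves two uses: \<open>a = 0\<close> for the whole
  sequence, and \<open>a = \<gamma>\<close> for \<open>W\<close> extended by auxiliary
  vertices.\<close>

theorem Erdos_Gallai:
  fixes a n :: nat and c :: "nat \<Rightarrow> nat"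
  assumes noninc: "\<And>i j. a < i \<Longrightarrow> i \<le> j \<Longrightarrow> j \<le> n \<Longrightarrow> c j \<le> c i"
    and even: "even (\<Sum>i=a+1..n. c i)"
    and EG: "\<And>r. a < r \<Longrightarrow> r \<le> n \<Longrightarrow>
      (\<Sum>i=a+1..r. c i) \<le> (r - a) * (r - a - 1) + (\<Sum>i=r+1..n. min (r - a) (c i))"
  obtains E where "simple_graph {a+1..n} E" "\<And>v. v \<in> {a+1..n} \<Longrightarrow> degree E v = c v"
proof -
  have sat: "\<exists>E. saturates a n c r E \<and> t \<le> degree E r"
    if "saturates a n c r E" "a < r" "r \<le> n" "t \<le> c r" for r t E
    using that(4)
  proof (induction t)
    case 0
    then show ?case using that by blast
  next
    case (Suc t)
    then obtain F where F: "saturates a n c r F" "t \<le> degree F r" by auto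
    show ?case
    proof (cases "t = degree F r")
      case True
      with saturates_step[OF noninc even EG that(2,3) F(1)] that(2,3) Suc.prems show ?thesis
        by (metis Suc_le_eq)
    next
      case False
      with F show ?thesis by (metis Suc_leI nat_less_le)
    qed
  qed
  have "\<exists>E. saturates a n c (a + 1 + k) E" if "a + k \<le> n" for k
    using that
  proof (induction k)
    case 0
    have "saturates a n c (a + 1 + 0) {}"
      by (auto simp: saturates_def simple_graph_def degree_def neighbours_def)
    then show ?case by blast
  next
    case (Suc k)
    then obtain E where "saturates a n c (a + 1 + k) E" by auto
    from sat[OF this, of "c (a + 1 + k)"] Suc.prems obtain F
      where F: "saturates a n c (a + 1 + k) F" "c (a + 1 + k) \<le> degree F (a + 1 + k)" by auto
    have "saturates a n c (a + 1 + Suc k) F"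
      using F Suc.prems unfolding saturates_def
      by (metis add_Suc_right le_SucI le_antisym less_Suc_eq)
    then show ?case by blast
  qed
  from this[of "n - a"] show ?thesis
  proof (cases "a \<le> n")
    case True
    with \<open>\<And>k. a + k \<le> n \<Longrightarrow> _\<close>[of "n - a"] obtain E where "saturates a n c (n + 1) E" by auto
    then show ?thesis using that[of E] by (auto simp: saturates_def)
  next
    case False
    then show ?thesis using that[of "{}"] by (auto simp: simple_graph_def)
  qed
qed

section \<open>Augmentation and deficiency\<close>

text \<open>The second graph toggles in \<open>H'\<close> exactly the edges that turn
  \<open>H\<close> into \<open>G\<close>, all of them from the symmetric difference. So whatever one
  graph gains at \<open>v\<close> the other loses.\<close>

lemma degree_mix:
  assumes H: "simple_graph V H" and H': "simple_graph V H'"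
    and G: "H \<inter> H' \<subseteq> G" "G \<subseteq> H \<union> H'"
  shows "degree G v + degree (H \<inter> H' \<union> (H \<union> H' - G)) v = degree H v + degree H' v"
proof -
  let ?G' = "H \<inter> H' \<union> (H \<union> H' - G)"
  have sub: "neighbours G v \<subseteq> neighbours H v \<union> neighbours H' v"
    "neighbours ?G' v \<subseteq> neighbours H v \<union> neighbours H' v"
    using G by (auto simp: neighbours_def)
  have fin: "finite (neighbours H v)" "finite (neighbours H' v)"
    using finite_neighbours[OF H] finite_neighbours[OF H'] by auto
  then have fin': "finite (neighbours G v)" "finite (neighbours ?G' v)"
    using sub finite_subset by blast+
  have "neighbours G v \<union> neighbours ?G' v = neighbours H v \<union> neighbours H' v"
    "neighbours G v \<inter> neighbours ?G' v = neighbours H v \<inter> neighbours H' v"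
    using G by (auto simp: neighbours_def)
  then show ?thesis
    unfolding degree_def using card_Un_Int[OF fin] card_Un_Int[OF fin'] by simp
qed

text \<open>
  \<open>G\<close> is \<open>H\<close> flipped along an alternating trail from \<open>y\<close> to \<open>z\<close>. Since it lies between \<open>H \<inter> H'\<close> and
  \<open>H \<union> H'\<close>, the same trail can be flipped in \<open>H'\<close> instead.
\<close>

lemma degree_exchange:
  assumes "simple_graph V H" and H': "simple_graph V H'" and "degree H y < degree H' y"
  shows "\<exists>G z. simple_graph V G \<and> H \<inter> H' \<subseteq> G \<and> G \<subseteq> H \<union> H' \<and>
    ((\<forall>v. degree G v = degree H v + of_bool (v = y) + of_bool (v = z)) \<and>
       degree H z + of_bool (z = y) < degree H' z \<or>
     (\<forall>v. degree G v + of_bool (v = z) = degree H v + of_bool (v = y)) \<and>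
       degree H' z < degree H z)"
  using assms(1,3)
proof (induction "card (H' - H)" arbitrary: H y rule: less_induct)
  case less
  note H = \<open>simple_graph V H\<close>
  have fin: "finite (neighbours H v)" "finite (neighbours H' v)" for v
    using finite_neighbours[OF H] finite_neighbours[OF H'] by auto
  have "\<not> neighbours H' y \<subseteq> neighbours H y"
    using less.prems(2) card_mono[OF fin(1), of "neighbours H' y" y] by (auto simp: degree_def)
  then obtain u where "u \<in> neighbours H' y" "u \<notin> neighbours H y" by blast
  then have u: "{y, u} \<in> H'" "{y, u} \<notin> H"
    by (simp_all add: mem_neighbours insert_commute)
  have yu: "y \<noteq> u" "y \<in> V" "u \<in> V" using edge_in[OF H' u(1)] by auto
  show ?case
  proof (cases "degree H u < degree H' u")
    case True
    show ?thesis
      by (intro exI[of _ "insert {y, u} H"] exI[of _ u] conjI disjI1)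
        (use True yu u degree_insert[OF H yu(1) u(2)] simple_graph_insert[OF H yu(2,3,1)] in auto)
  next
    \<comment> \<open>Here \<open>u\<close> is not short of edges although it misses
      \<open>y\<close>, so some \<open>v\<close> is its neighbour in \<open>H\<close> only. Trading
      \<open>uv\<close> for \<open>yu\<close> moves the missing unit from \<open>y\<close> to
      \<open>v\<close>, where the trail stops or continues; \<open>yu\<close> leaves
      \<open>H' - H\<close>, so the measure drops.\<close>
    case False
    have "y \<in> neighbours H' u - neighbours H u" using u by (auto simp: neighbours_def)
    then have "neighbours H u \<subseteq> neighbours H' u \<Longrightarrow> neighbours H u \<subset> neighbours H' u" by auto
    then have "\<not> neighbours H u \<subseteq> neighbours H' u"
      using False psubset_card_mono[OF fin(2)[of u], of "neighbours H u"]
      by (auto simp: degree_def)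
    then obtain v where "v \<in> neighbours H u" "v \<notin> neighbours H' u" by blast
    then have v: "{u, v} \<in> H" "{u, v} \<notin> H'"
      by (simp_all add: mem_neighbours insert_commute)
    have vy: "v \<noteq> y" using u v by (auto simp: insert_commute)
    define H0 where "H0 = H - {{u, v}}"
    define H1 where "H1 = insert {y, u} H0"
    have s0: "simple_graph V H0" unfolding H0_def by (rule simple_graph_diff[OF H])
    have s1: "simple_graph V H1" unfolding H1_def by (rule simple_graph_insert[OF s0 yu(2,3,1)])
    have yu0: "{y, u} \<notin> H0" using u by (auto simp: H0_def)
    have d: "degree H1 x + of_bool (x = v) = degree H x + of_bool (x = y)" for x
      using degree_remove[OF H v(1), of x] degree_insert[OF s0 yu(1) yu0, of x]
      by (simp add: H0_def H1_def)
    have mid: "H \<inter> H' \<subseteq> H1" "H1 \<subseteq> H \<union> H'" "H \<inter> H' \<subseteq> H1 \<inter> H'" "H1 \<union> H' \<subseteq> H \<union> H'"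
      using u v by (auto simp: H1_def H0_def)
    show ?thesis
    proof (cases "degree H' v < degree H v")
      case True
      then show ?thesis
        by (intro exI[of _ H1] exI[of _ v] conjI disjI2 allI s1 mid(1,2) d)
    next
      case False
      have eq: "H' - H1 = (H' - H) - {{y, u}}" using v unfolding H1_def H0_def by blast
      have c1: "card (H' - H1) < card (H' - H)"
        unfolding eq using u finite_edges[OF H'] by (intro card_Diff1_less) auto
      have c2: "degree H1 v < degree H' v" using d[of v] vy False by auto
      obtain G z where G: "simple_graph V G" "H1 \<inter> H' \<subseteq> G" "G \<subseteq> H1 \<union> H'"
        and alt: "(\<forall>x. degree G x = degree H1 x + of_bool (x = v) + of_bool (x = z)) \<and>
             degree H1 z + of_bool (z = v) < degree H' z \<or>
           (\<forall>x. degree G x + of_bool (x = z) = degree H1 x + of_bool (x = v)) \<and>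
             degree H' z < degree H1 z"
        using less.hyps[OF c1 s1 c2] by (elim exE conjE) (rule that)
      have mid': "H \<inter> H' \<subseteq> G" "G \<subseteq> H \<union> H'" using G(2,3) mid(3,4) by auto
      from alt show ?thesis
      proof (elim disjE conjE)
        assume a: "\<forall>x. degree G x = degree H1 x + of_bool (x = v) + of_bool (x = z)"
          "degree H1 z + of_bool (z = v) < degree H' z"
        have "degree G x = degree H x + of_bool (x = y) + of_bool (x = z)" for x
          using spec[OF a(1), of x] d[of x] by linarith
        then show ?thesis using a(2) d[of z] mid' G(1)
          by (intro exI[of _ G] exI[of _ z] conjI disjI1) auto
      next
        assume a: "\<forall>x. degree G x + of_bool (x = z) = degree H1 x + of_bool (x = v)"
          "degree H' z < degree H1 z"
        have "degree G x + of_bool (x = z) = degree H x + of_bool (x = y)" for x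
          using spec[OF a(1), of x] d[of x] by linarith
        moreover have "degree H' z < degree H z"
          using a(2) d[of z] less.prems(2) by (cases "z = y") auto
        ultimately show ?thesis using mid' G(1)
          by (intro exI[of _ G] exI[of _ z] conjI disjI2) auto
      qed
    qed
  qed
qed

text \<open>\<open>H\<close> stays fixed while \<open>H'\<close> is changed; the truncated
  differences in the measure count only the vertices where \<open>H'\<close> is ahead. The strict
  bounds against \<open>H'\<close> are kept because \<open>repair\<close> turns them into spare
  dominators of \<open>y\<close> and \<open>z\<close>.\<close>

lemma degree_augment:
  assumes H: "simple_graph V H" and "simple_graph V H'"
    and "(\<Sum>v\<in>V. degree H v) < (\<Sum>v\<in>V. degree H' v)"
  shows "\<exists>G y z. simple_graph V G \<and>
    (\<forall>v. degree G v = degree H v + of_bool (v = y) + of_bool (v = z)) \<and>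
    degree H y + of_bool (y = z) < degree H' y \<and> degree H z + of_bool (y = z) < degree H' z"
  using assms(2,3)
proof (induction "\<Sum>v\<in>V. degree H' v - degree H v" arbitrary: H' rule: less_induct)
  case less
  note H' = \<open>simple_graph V H'\<close>
  have "\<not> (\<forall>v\<in>V. degree H' v \<le> degree H v)"
  proof
    assume "\<forall>v\<in>V. degree H' v \<le> degree H v"
    then have "(\<Sum>v\<in>V. degree H' v) \<le> (\<Sum>v\<in>V. degree H v)" by (intro sum_mono) blast
    with less.prems(2) show False by simp
  qed
  then obtain y where y: "y \<in> V" "degree H y < degree H' y" by (auto simp: not_le)
  obtain G z where G: "simple_graph V G" "H \<inter> H' \<subseteq> G" "G \<subseteq> H \<union> H'"
    and alt: "(\<forall>v. degree G v = degree H v + of_bool (v = y) + of_bool (v = z)) \<and>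
       degree H z + of_bool (z = y) < degree H' z \<or>
     (\<forall>v. degree G v + of_bool (v = z) = degree H v + of_bool (v = y)) \<and>
       degree H' z < degree H z"
    using degree_exchange[OF H H' y(2)] by (elim exE conjE) (rule that)
  from alt show ?case
  proof
    assume a: "(\<forall>v. degree G v = degree H v + of_bool (v = y) + of_bool (v = z)) \<and>
       degree H z + of_bool (z = y) < degree H' z"
    then have "degree H y + of_bool (y = z) < degree H' y" using y by (cases "y = z") auto
    with a G(1) show ?thesis
      by (intro exI[of _ G] exI[of _ y] exI[of _ z]) (cases "y = z"; simp)
  next
    assume a: "(\<forall>v. degree G v + of_bool (v = z) = degree H v + of_bool (v = y)) \<and>
       degree H' z < degree H z"
    txt \<open>The trail does not increase the size of \<open>H\<close>; flipped in \<open>H'\<close>, it brings \<open>H'\<close> closer to \<open>H\<close>.\<close>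
    let ?G' = "H \<inter> H' \<union> (H \<union> H' - G)"
    have s': "simple_graph V ?G'" using H H' by (auto simp: simple_graph_def)
    have d: "degree ?G' v + of_bool (v = y) = degree H' v + of_bool (v = z)" for v
      using degree_mix[OF H H' G(2,3), of v] spec[OF conjunct1[OF a], of v] by linarith
    have zy: "z \<noteq> y" using a y by auto
    have "neighbours H z \<noteq> {}" using a by (auto simp: degree_def)
    then have "z \<in> V" using edge_in(2)[OF H] by (auto simp: neighbours_def)
    moreover have "(\<Sum>v\<in>V. degree ?G' v + of_bool (v = y)) =
        (\<Sum>v\<in>V. degree H' v + of_bool (v = z))"
      by (rule sum.cong[OF refl d])
    ultimately have "(\<Sum>v\<in>V. degree ?G' v) = (\<Sum>v\<in>V. degree H' v)"
      using y finite_vertices[OF H] by (simp add: sum.distrib of_bool_def)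
    then have lt: "(\<Sum>v\<in>V. degree H v) < (\<Sum>v\<in>V. degree ?G' v)" using less.prems by simp
    have le: "degree ?G' v - degree H v \<le> degree H' v - degree H v" for v
      using d[of v] conjunct2[OF a] by (cases "v = z") (auto simp: of_bool_def split: if_splits)
    have "degree ?G' y - degree H y < degree H' y - degree H y"
      using d[of y] y zy by auto
    then have "(\<Sum>v\<in>V. degree ?G' v - degree H v) < (\<Sum>v\<in>V. degree H' v - degree H v)"
      using le y finite_vertices[OF H] by (intro sum_strict_mono_ex1) auto
    from less.hyps[OF this s' lt] obtain F y' z' where F: "simple_graph V F"
      "\<forall>v. degree F v = degree H v + of_bool (v = y') + of_bool (v = z')"
      "degree H y' + of_bool (y' = z') < degree ?G' y'" "degree H z' + of_bool (y' = z') < degree ?G' z'"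
      by (elim exE conjE) (rule that)
    have "degree H x + of_bool b < degree H' x" if "degree H x + of_bool b < degree ?G' x" for x b
      using le[of x] that by linarith
    then show ?thesis
      using F by (intro exI[of _ F] exI[of _ y'] exI[of _ z'] conjI) simp_all
  qed
qed

text \<open>The Erdos-Gallai theorem applied to the positive part of \<open>c\<close> extended by \<open>\<delta>\<close> vertices of degree 1.\<close>

lemma Erdos_Gallai_deficiency:
  fixes a n :: nat and c :: "nat \<Rightarrow> nat" and \<delta> :: nat
  assumes noninc: "\<And>i j. a < i \<Longrightarrow> i \<le> j \<Longrightarrow> j \<le> n \<Longrightarrow> c j \<le> c i"
    and even: "even ((\<Sum>i=a+1..n. c i) + \<delta>)"
    and EG: "\<And>r. a < r \<Longrightarrow> r \<le> n \<Longrightarrow>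
      (\<Sum>i=a+1..r. c i) \<le> (r - a) * (r - a - 1) + (\<Sum>i=r+1..n. min (r - a) (c i)) + \<delta>"
  obtains H where "simple_graph {a+1..n} H" "\<And>v. v \<in> {a+1..n} \<Longrightarrow> degree H v \<le> c v"
    "(\<Sum>i=a+1..n. c i) \<le> (\<Sum>i=a+1..n. degree H i) + \<delta>"
proof (cases "\<exists>i\<in>{a+1..n}. 0 < c i")
  case False
  then show ?thesis
    using that[of "{}"] by (auto simp: simple_graph_def degree_def neighbours_def)
next
  case True
  define P where "P = {i \<in> {a+1..n}. 0 < c i}"
  define m where "m = Max P"
  have P: "finite P" "P \<noteq> {}" using True by (auto simp: P_def)
  have m: "a < m" "m \<le> n" "0 < c m" using Max_in[OF P] by (auto simp: m_def P_def)
  have pos: "0 < c i" if "a < i" "i \<le> m" for i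
    using noninc[of i m] that m by auto
  have zero: "c i = 0" if "m < i" "i \<le> n" for i
    using Max_ge[OF P(1), of i] that m by (fastforce simp: m_def P_def)
  \<comment> \<open>The zeros of \<open>c\<close> are cut off at \<open>m\<close>; placed before the
    appended ones they would destroy monotonicity.\<close>
  define c' where "c' i = (if i \<le> m then c i else 1)" for i
  let ?K = "{a+1..m}" and ?L = "{m+1..m+\<delta>}"
  have split: "{a+1..n} = ?K \<union> {m+1..n}" and split': "{a+1..m+\<delta>} = ?K \<union> ?L" using m by auto
  have sumc: "(\<Sum>i=a+1..n. f i) = (\<Sum>i\<in>?K. f i)" if "\<And>i. m < i \<Longrightarrow> i \<le> n \<Longrightarrow> f i = 0"
    for f :: "nat \<Rightarrow> nat"
    using that m by (intro sum.mono_neutral_right) auto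
  have "even (\<Sum>i=a+1..m+\<delta>. c' i)"
  proof -
    have "(\<Sum>i=a+1..m+\<delta>. c' i) = (\<Sum>i\<in>?K. c' i) + (\<Sum>i\<in>?L. c' i)"
      unfolding split' by (rule sum.union_disjoint) auto
    also have "\<dots> = (\<Sum>i\<in>?K. c i) + \<delta>" by (simp add: c'_def)
    finally show ?thesis using even sumc[of c] zero by simp
  qed
  moreover have "(\<Sum>i=a+1..r. c' i) \<le> (r - a) * (r - a - 1) + (\<Sum>i=r+1..m+\<delta>. min (r - a) (c' i))"
    if r: "a < r" "r \<le> m + \<delta>" for r
  proof (cases "r \<le> m")
    case True
    have "(\<Sum>i=r+1..n. min (r - a) (c i)) = (\<Sum>i=r+1..m. min (r - a) (c i))"
      using zero m True by (intro sum.mono_neutral_right) auto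
    moreover have "(\<Sum>i=r+1..m+\<delta>. min (r - a) (c' i)) =
        (\<Sum>i\<in>{r+1..m}. min (r - a) (c' i)) + (\<Sum>i\<in>?L. min (r - a) (c' i))"
      using True by (subst sum.union_disjoint[symmetric]) (auto intro!: sum.cong)
    moreover have "(\<Sum>i\<in>?L. min (r - a) (c' i)) = \<delta>" using r by (simp add: c'_def)
    moreover have "(\<Sum>i=a+1..r. c' i) = (\<Sum>i=a+1..r. c i)" using True by (simp add: c'_def)
    moreover have "(\<Sum>i\<in>{r+1..m}. min (r - a) (c' i)) = (\<Sum>i\<in>{r+1..m}. min (r - a) (c i))"
      by (simp add: c'_def)
    ultimately show ?thesis using EG[of r] r True m by simp
  next
    case False
    define p where "p = m - a"
    define j where "j = r - m"
    have pj: "p \<ge> 1" "j \<ge> 1" "r - a = p + j" "j \<le> \<delta>" using m False r by (auto simp: p_def j_def)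
    have "(\<Sum>i=a+1..r. c' i) = (\<Sum>i\<in>?K. c' i) + (\<Sum>i\<in>{m+1..r}. c' i)"
      using False m by (subst sum.union_disjoint[symmetric]) (auto intro!: sum.cong)
    then have 1: "(\<Sum>i=a+1..r. c' i) = (\<Sum>i\<in>?K. c i) + j" by (simp add: c'_def j_def)
    have 2: "(\<Sum>i=r+1..m+\<delta>. min (r - a) (c' i)) = \<delta> - j"
      using False pj by (simp add: c'_def j_def)
    have "(\<Sum>i=m+1..n. min (m - a) (c i)) = 0" using zero by simp
    then have 3: "(\<Sum>i\<in>?K. c i) \<le> p * (p - 1) + \<delta>" using EG[of m] m by (simp add: p_def)
    obtain p' j' where "p = Suc p'" "j = Suc j'" using pj by (metis Suc_le_D One_nat_def)
    \<comment> \<open>The \<open>j\<close> ones already passed count on the left and are missing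
      from the tail on the right, so \<open>2 * j\<close> has to be absorbed by the larger clique
      term.\<close>
    then have "p * (p - 1) + 2 * j \<le> (p + j) * (p + j - 1)" by (simp add: algebra_simps)
    then show ?thesis using 1 2 3 pj by simp
  qed
  moreover have "c' j \<le> c' i" if "a < i" "i \<le> j" "j \<le> m + \<delta>" for i j
    using that noninc[of i j] pos[of i] m by (auto simp: c'_def)
  ultimately obtain E where E: "simple_graph {a+1..m+\<delta>} E"
    "\<And>v. v \<in> {a+1..m+\<delta>} \<Longrightarrow> degree E v = c' v"
    using Erdos_Gallai[of a "m + \<delta>" c'] by blast
  define H where "H = {e \<in> E. e \<subseteq> ?K}"
  have nH: "neighbours H v = (if v \<in> ?K then neighbours E v \<inter> ?K else {})" for v
    by (auto simp: H_def neighbours_def)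
  have dK: "degree E v = card (neighbours E v \<inter> ?K) + card (neighbours E v \<inter> ?L)" for v
  proof -
    have "neighbours E v = neighbours E v \<inter> ?K \<union> neighbours E v \<inter> ?L"
      using neighbours_sub[OF E(1), of v] by auto
    then show ?thesis
      unfolding degree_def by (subst card_Un_disjoint[symmetric]) auto
  qed
  show ?thesis
  proof (rule that[of H])
    show "simple_graph {a+1..n} H" using E(1) m by (fastforce simp: simple_graph_def H_def)
    show "degree H v \<le> c v" if "v \<in> {a+1..n}" for v
      using dK[of v] E(2)[of v] nH[of v] that by (auto simp: degree_def c'_def)
    have "(\<Sum>v\<in>?K. c v) = (\<Sum>v\<in>?K. degree E v)" using E(2) by (simp add: c'_def)
    also have "\<dots> = (\<Sum>v\<in>?K. degree H v) + (\<Sum>v\<in>?K. card (neighbours E v \<inter> ?L))"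
      using nH[THEN arg_cong[of _ _ card]] by (simp add: dK sum.distrib degree_def[of H])
    also have "(\<Sum>v\<in>?K. card (neighbours E v \<inter> ?L)) = (\<Sum>v\<in>?L. card (neighbours E v \<inter> ?K))"
      by (rule sum_degree_eq[OF E(1)]) (use m in auto)
    \<comment> \<open>An auxiliary vertex has degree one, so discarding all of them costs the
      vertices of \<open>?K\<close> at most \<open>\<delta>\<close> in total.\<close>
    also have "\<dots> \<le> (\<Sum>v\<in>?L. 1)"
    proof (rule sum_mono)
      fix v assume "v \<in> ?L"
      then have "degree E v = 1" using E(2)[of v] m by (simp add: c'_def)
      then show "card (neighbours E v \<inter> ?K) \<le> 1" unfolding dK by linarith
    qed
    finally show "(\<Sum>i=a+1..n. c i) \<le> (\<Sum>i=a+1..n. degree H i) + \<delta>"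
      using sumc[of c] zero sumc[of "degree H"] nH by (simp add: degree_def)
  qed
qed

section \<open>Repairing undominated vertices\<close>

lemma move_edge:
  assumes sg: "simple_graph V E" and "{y, a} \<in> E" "{p, a} \<notin> E" "p \<in> V" "p \<noteq> a"
  shows "simple_graph V (insert {p, a} (E - {{y, a}}))"
    and "degree (insert {p, a} (E - {{y, a}})) v + of_bool (v = y) = degree E v + of_bool (v = p)"
proof -
  have s: "simple_graph V (E - {{y, a}})" by (rule simple_graph_diff[OF sg])
  show "simple_graph V (insert {p, a} (E - {{y, a}}))"
    by (rule simple_graph_insert[OF s]) (use assms edge_in[OF sg assms(2)] in simp_all)
  show "degree (insert {p, a} (E - {{y, a}})) v + of_bool (v = y) = degree E v + of_bool (v = p)"
    using degree_remove[OF sg assms(2), of v] degree_insert[OF s assms(5), of v] assms(3) by simp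
qed

definition undominated :: "nat \<Rightarrow> nat \<Rightarrow> nat set set \<Rightarrow> nat set" where
  "undominated \<gamma> n E = {v \<in> {\<gamma>+1..n}. \<forall>u\<in>{1..\<gamma>}. {u, v} \<notin> E}"

text \<open>Conditions (2) and (3) stay outside: (2) is spent on finding some realization, and (3)
  enters only to contradict the extremal configuration.\<close>

locale domination_conditions =
  fixes n \<gamma> :: nat and d :: "nat \<Rightarrow> nat"
  assumes gamma: "\<gamma> \<le> n"
    and pos: "\<And>i. 1 \<le> i \<Longrightarrow> i \<le> n \<Longrightarrow> 0 < d i"
    and noninc: "\<And>i j. 1 \<le> i \<Longrightarrow> i \<le> j \<Longrightarrow> j \<le> n \<Longrightarrow> d j \<le> d i"
    and even: "even (\<Sum>i=1..n. d i)"
    and c1: "\<And>k. k \<le> n - \<gamma> \<Longrightarrow> (\<Sum>i=\<gamma>+1..\<gamma>+k. int (d i) - 1)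
         \<le> int k * (int k - 1) - (int n - int \<gamma>) + (\<Sum>i=1..\<gamma>. int (d i))
           + (\<Sum>i=\<gamma>+k+1..n. min (int k) (int (d i) - 1))"
begin

abbreviation "V \<equiv> {1..n}"
abbreviation "D \<equiv> {1..\<gamma>}"
abbreviation "W \<equiv> {\<gamma>+1..n}"

lemma V_split: "V = D \<union> W" "D \<inter> W = {}"
  using gamma by auto

lemma sum_V: "(\<Sum>i\<in>V. f i) = (\<Sum>i\<in>D. f i) + (\<Sum>i\<in>W. f i :: nat)"
  unfolding V_split(1) by (rule sum.union_disjoint) (use V_split in auto)

text \<open>Reserve for each vertex of \<open>W\<close> one edge to \<open>D\<close>. This leaves
  \<open>c = d - 1\<close> on \<open>W\<close> and \<open>\<delta>\<close> free edge ends at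
  \<open>D\<close>. Condition (1) at \<open>k = 0\<close> says that \<open>\<delta>\<close> is
  nonnegative, and at \<open>k = r - \<gamma>\<close> it is the inequality with deficiency
  \<open>\<delta>\<close>.\<close>

lemma exists_W_graph:
  obtains H where "simple_graph W H" "\<And>v. v \<in> W \<Longrightarrow> degree H v < d v"
    "(\<Sum>i\<in>W. d i) \<le> (\<Sum>i\<in>W. degree H i) + (\<Sum>i\<in>D. d i)"
proof -
  define c where "c i = d i - 1" for i
  have dc: "d i = c i + 1" if "i \<in> W" for i using pos[of i] that by (simp add: c_def)
  have "(\<Sum>i\<in>W. d i) = (\<Sum>i\<in>W. c i + 1)" by (rule sum.cong[OF refl dc])
  then have W: "(\<Sum>i\<in>W. d i) = (\<Sum>i\<in>W. c i) + (n - \<gamma>)" unfolding sum.distrib by simp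
  have "n - \<gamma> \<le> (\<Sum>i\<in>D. d i)"
    using c1[of 0] pos by (simp add: of_nat_diff gamma flip: of_nat_sum)
  then obtain \<delta> where \<delta>: "(\<Sum>i\<in>D. d i) = (n - \<gamma>) + \<delta>" using le_Suc_ex by blast
  obtain H where H: "simple_graph W H" "\<And>v. v \<in> W \<Longrightarrow> degree H v \<le> c v"
    "(\<Sum>i\<in>W. c i) \<le> (\<Sum>i\<in>W. degree H i) + \<delta>"
  proof (rule Erdos_Gallai_deficiency[of \<gamma> n c \<delta>])
    show "c j \<le> c i" if "\<gamma> < i" "i \<le> j" "j \<le> n" for i j
      using noninc[of i j] that by (simp add: c_def)
    have "(\<Sum>i\<in>V. d i) = ((\<Sum>i\<in>W. c i) + \<delta>) + 2 * (n - \<gamma>)"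
      unfolding sum_V W \<delta> by simp
    then show "even ((\<Sum>i\<in>W. c i) + \<delta>)"
      using even by (metis dvd_add_left_iff dvd_triv_left)
    fix r assume r: "\<gamma> < r" "r \<le> n"
    define k where "k = r - \<gamma>"
    have k: "\<gamma> + k = r" "k \<le> n - \<gamma>" "1 \<le> k" using r by (auto simp: k_def)
    have "(\<Sum>i=\<gamma>+1..r. int (d i) - 1) = int (\<Sum>i=\<gamma>+1..r. c i)"
      using dc r by simp
    moreover have "(\<Sum>i=r+1..n. min (int k) (int (d i) - 1)) = int (\<Sum>i=r+1..n. min k (c i))"
      using dc r by (simp add: of_nat_min)
    moreover have "(\<Sum>i=1..\<gamma>. int (d i)) = int n - int \<gamma> + int \<delta>"
      using \<delta> gamma by (simp add: of_nat_diff flip: of_nat_sum)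
    moreover have "int k * (int k - 1) = int (k * (k - 1))" using k by (simp add: of_nat_diff)
    ultimately have "int (\<Sum>i=\<gamma>+1..r. c i) \<le> int (k * (k - 1) + (\<Sum>i=r+1..n. min k (c i)) + \<delta>)"
      using c1[OF k(2)] unfolding k(1) of_nat_add by linarith
    then show "(\<Sum>i=\<gamma>+1..r. c i) \<le> (r - \<gamma>) * (r - \<gamma> - 1) + (\<Sum>i=r+1..n. min (r - \<gamma>) (c i)) + \<delta>"
      unfolding k_def by linarith
  qed (use that in blast)
  show ?thesis
  proof (rule that[OF H(1)])
    show "degree H v < d v" if "v \<in> W" for v using H(2)[OF that] dc[OF that] by simp
    show "(\<Sum>i\<in>W. d i) \<le> (\<Sum>i\<in>W. degree H i) + (\<Sum>i\<in>D. d i)" using H(3) W \<delta> by simp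
  qed
qed

text \<open>
  The case \<open>p = q\<close>, a vertex lacking two edges, is included. An edge inside \<open>D\<close> can be replaced by
  edges to \<open>p\<close> and \<open>q\<close>. Otherwise the part of \<open>E\<close> in \<open>W\<close> is augmented at \<open>y\<close> and \<open>z\<close>, which
  then have spare dominators to hand over.
\<close>

lemma repair:
  assumes sg: "simple_graph V E"
    and deg: "\<And>v. v \<in> V \<Longrightarrow> degree E v + of_bool (v = p) + of_bool (v = q) = d v"
    and pq: "p \<in> undominated \<gamma> n E" "q \<in> undominated \<gamma> n E"
  shows "\<exists>E'. realizes n E' d \<and> undominated \<gamma> n E' \<subseteq> undominated \<gamma> n E - {p, q}"
proof (cases "\<exists>a\<in>D. \<exists>b\<in>D. {a, b} \<in> E")
  case True
  then obtain a b where ab: "a \<in> D" "b \<in> D" "{a, b} \<in> E" by blast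
  have ne: "a \<noteq> b" using edge_in(3)[OF sg ab(3)] .
  have pW: "p \<in> W" "q \<in> W" and nD: "{p, a} \<notin> E" "{q, b} \<notin> E"
    using pq ab by (auto simp: undominated_def insert_commute)
  have pa: "p \<noteq> a" "q \<noteq> b" "p \<noteq> b" "q \<noteq> a" using pW ab by auto
  let ?E1 = "insert {p, a} (E - {{b, a}})"
  have ba: "{b, a} \<in> E" using ab by (simp add: insert_commute)
  have pV: "p \<in> V" "q \<in> V" using pW by auto
  note m = move_edge[OF sg ba nD(1) pV(1) pa(1)]
  have nq: "{q, b} \<notin> ?E1" using nD pa ne by (auto simp: doubleton_eq_iff)
  let ?E2 = "insert {q, b} ?E1"
  have s2: "simple_graph V ?E2"
    by (rule simple_graph_insert[OF m(1)]) (use pV ab gamma pa in auto)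
  have "degree ?E2 v = d v" if "v \<in> V" for v
    using degree_insert[OF m(1) pa(2) nq, of v] m(2)[of v] deg[OF that] by linarith
  then have "realizes n ?E2 d" using s2 by (simp add: realizes_def)
  moreover have "undominated \<gamma> n ?E2 \<subseteq> undominated \<gamma> n E - {p, q}"
  proof
    fix v assume "v \<in> undominated \<gamma> n ?E2"
    then have vW: "v \<in> W" and vF: "\<And>s. s \<in> D \<Longrightarrow> {v, s} \<notin> ?E2"
      by (simp_all add: undominated_def insert_commute)
    have "{v, s} \<notin> E" if "s \<in> D" for s
    proof -
      have "{v, s} \<noteq> {b, a}" using vW ab by (simp add: doubleton_eq_iff)
      then show ?thesis using vF[OF that] by blast
    qed
    moreover have "v \<noteq> p" "v \<noteq> q" using vF[OF ab(1)] vF[OF ab(2)] by blast+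
    ultimately show "v \<in> undominated \<gamma> n E - {p, q}"
      using vW by (simp add: undominated_def insert_commute)
  qed
  ultimately show ?thesis by blast
next
  case False
  then have indep: "{a, b} \<notin> E" if "a \<in> D" "b \<in> D" for a b using that by blast
  have pW: "p \<in> W" "q \<in> W" and nD: "\<And>a. a \<in> D \<Longrightarrow> {a, p} \<notin> E" "\<And>a. a \<in> D \<Longrightarrow> {a, q} \<notin> E"
    using pq by (auto simp: undominated_def)
  define H where "H = {e \<in> E. e \<subseteq> W}"
  have sH: "simple_graph W H" using sg by (auto simp: simple_graph_def H_def)
  have nH: "neighbours H v = neighbours E v \<inter> W" if "v \<in> W" for v
    using that by (auto simp: H_def neighbours_def)
  define N where "N v = neighbours E v \<inter> D" for v
  have fN: "finite (N v)" for v by (simp add: N_def)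
  have dW: "degree E v = degree H v + card (N v)" if "v \<in> W" for v
  proof -
    have "neighbours E v = neighbours E v \<inter> W \<union> neighbours E v \<inter> D"
      using neighbours_sub[OF sg, of v] V_split by blast
    then show ?thesis
      unfolding degree_def nH[OF that] N_def
      using card_Un_disjoint[of "neighbours E v \<inter> W" "neighbours E v \<inter> D"] V_split(2)
      by (metis (no_types, lifting) Int_assoc Int_commute Int_empty_left Int_empty_right
          finite_Int finite_atLeastAtMost)
  qed
  obtain H' where H': "simple_graph W H'" "\<And>v. v \<in> W \<Longrightarrow> degree H' v < d v"
    "(\<Sum>i\<in>W. d i) \<le> (\<Sum>i\<in>W. degree H' i) + (\<Sum>i\<in>D. d i)"
    using exists_W_graph by blast
  have "(\<Sum>v\<in>W. card (N v)) = (\<Sum>v\<in>D. card (neighbours E v \<inter> W))"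
    unfolding N_def by (rule sum_degree_eq[OF sg]) (use gamma in auto)
  also have "\<dots> = (\<Sum>v\<in>D. d v)"
  proof (rule sum.cong[OF refl])
    fix v assume v: "v \<in> D"
    have "neighbours E v \<inter> W = neighbours E v"
      using neighbours_sub[OF sg, of v] indep v V_split(1) by (auto simp: mem_neighbours)
    then show "card (neighbours E v \<inter> W) = d v"
      using deg[of v] v pW gamma by (auto simp: degree_def)
  qed
  finally have sN: "(\<Sum>v\<in>W. card (N v)) = (\<Sum>v\<in>D. d v)" .
  \<comment> \<open>With \<open>D\<close> independent, all degree of \<open>D\<close> goes to
    \<open>W\<close>. The two units missing at \<open>p\<close> and \<open>q\<close> are therefore
    missing from \<open>H\<close>, whereas \<open>H'\<close> reaches the full amount.\<close>
  have "(\<Sum>v\<in>W. d v) = (\<Sum>v\<in>W. degree H v + card (N v) + of_bool (v = p) + of_bool (v = q))"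
    by (rule sum.cong[OF refl]) (use deg dW in \<open>auto simp flip: dW\<close>)
  also have "\<dots> = (\<Sum>v\<in>W. degree H v) + (\<Sum>v\<in>D. d v) + 2"
    unfolding sum.distrib sN using pW by (simp add: of_bool_def)
  finally have lt: "(\<Sum>v\<in>W. degree H v) < (\<Sum>v\<in>W. degree H' v)" using H'(3) by simp
  obtain G y z where G: "simple_graph W G"
    "\<forall>v. degree G v = degree H v + of_bool (v = y) + of_bool (v = z)"
    "degree H y + of_bool (y = z) < degree H' y" "degree H z + of_bool (y = z) < degree H' z"
    using degree_augment[OF sH H'(1) lt] by (elim exE conjE) (rule that)
  have inW: "v \<in> W" if "degree H' v > 0" for v
  proof -
    have "neighbours H' v \<noteq> {}" using that by (auto simp: degree_def)
    then show ?thesis using edge_in(2)[OF H'(1)] by (auto simp: neighbours_def)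
  qed
  have yzW: "y \<in> W" "z \<in> W" using G(3,4) inW[of y] inW[of z] by auto
  define E2 where "E2 = (E - H) \<union> G"
  have s2: "simple_graph V E2"
    using sg G(1) gamma by (fastforce simp: simple_graph_def E2_def)
  have E2D: "{a, v} \<in> E2 \<longleftrightarrow> {a, v} \<in> E" if "a \<in> D" for a v
    using that G(1) by (auto simp: E2_def H_def simple_graph_def)
  have d2: "degree E2 v = degree E v + of_bool (v = y) + of_bool (v = z)" if "v \<in> V" for v
  proof (cases "v \<in> W")
    case True
    have "neighbours E2 v = neighbours G v \<union> N v"
      using True neighbours_sub[OF sg, of v] V_split E2D
      by (auto simp: mem_neighbours N_def E2_def H_def)
    moreover have "neighbours G v \<inter> N v = {}"
      using neighbours_sub[OF G(1), of v] by (auto simp: N_def)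
    ultimately have "degree E2 v = degree G v + card (N v)"
      unfolding degree_def using fN finite_neighbours[OF G(1)] by (simp add: card_Un_disjoint)
    then show ?thesis using spec[OF G(2), of v] dW[OF True] by simp
  next
    case False
    then have "v \<in> D" using that V_split by blast
    then have "neighbours E2 v = neighbours E v"
      using E2D[of v] by (auto simp: mem_neighbours insert_commute)
    then show ?thesis using yzW False by (auto simp: degree_def)
  qed
  \<comment> \<open>One unit comes from \<open>degree H' < d\<close>, the other from the
    augmentation bound. If \<open>y = z\<close>, two dominators must be given away there and the
    bound supplies a third.\<close>
  have Ncard: "card (N x) \<ge> 2 + of_bool b"
    if "x \<in> W" "x \<noteq> p" "x \<noteq> q" "degree H x + of_bool b < degree H' x" for x b
    using dW[OF that(1)] deg[of x] that H'(2)[OF that(1)] by simp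
  \<comment> \<open>The vertices \<open>p\<close> and \<open>q\<close> have no dominators, so the
    slack of two must come from their missing edges: a single vertex lacks both, and the
    augmentation cannot use it twice.\<close>
  have Npq: "p = q \<and> \<not> b"
    if "x \<in> W" "x = p \<or> x = q" "degree H x + of_bool b < degree H' x" for x b
  proof -
    have "N x = {}" using that nD by (auto simp: N_def mem_neighbours)
    then show ?thesis
      using dW[OF that(1)] deg[of x] that H'(2)[OF that(1)] by (auto simp: of_bool_def split: if_splits)
  qed
  have mem_N: "a \<in> N v \<longleftrightarrow> a \<in> D \<and> {v, a} \<in> E2" for a v
    using E2D[of a v] by (auto simp: N_def mem_neighbours insert_commute)
  have nD2: "{p, a} \<notin> E2" "{q, a} \<notin> E2" if "a \<in> D" for a
    using that nD E2D[of a p] E2D[of a q] by (simp_all add: insert_commute)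
  have undN: "undominated \<gamma> n F = {v \<in> W. \<forall>a\<in>D. {v, a} \<notin> F}" for F
    by (auto simp: undominated_def insert_commute)
  have undE: "undominated \<gamma> n E = {v \<in> W. N v = {}}"
    by (auto simp: undominated_def N_def mem_neighbours)
  have pV: "p \<in> V" "q \<in> V" using pW by auto
  \<comment> \<open>The augmentation has already supplied one of the two edges missing at
    \<open>p\<close>; the other is taken from a dominator of \<open>x\<close>.\<close>
  have single: ?thesis
    if pq: "p = q" and x: "x \<in> W" "x \<noteq> p" "card (N x) \<ge> 2"
      and dx: "\<And>v. v \<in> V \<Longrightarrow> degree E2 v = degree E v + of_bool (v = p) + of_bool (v = x)" for x
  proof -
    obtain a where a: "a \<in> N x" using x by fastforce
    then have a': "a \<in> D" "{x, a} \<in> E2" using mem_N by auto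
    have pa: "p \<noteq> a" using a' pW by auto
    note m = move_edge[OF s2 a'(2) nD2(1)[OF a'(1)] pV(1) pa]
    let ?F = "insert {p, a} (E2 - {{x, a}})"
    have "degree ?F v = d v" if "v \<in> V" for v
      using m(2)[of v] dx[OF that] deg[OF that] pq by simp
    then have "realizes n ?F d" using m(1) by (simp add: realizes_def)
    moreover have "undominated \<gamma> n ?F \<subseteq> undominated \<gamma> n E - {p, q}"
    proof
      fix v assume v: "v \<in> undominated \<gamma> n ?F"
      then have vW: "v \<in> W" and vF: "\<And>s. s \<in> D \<Longrightarrow> {v, s} \<notin> ?F" by (auto simp: undN)
      have "v \<noteq> p" using vF[OF a'(1)] by auto
      moreover have "N v \<subseteq> (if v = x then {a} else {})"
      proof
        fix s assume s: "s \<in> N v"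
        then have "{v, s} = {x, a}" using vF[of s] mem_N[of s v] by blast
        then show "s \<in> (if v = x then {a} else {})" using vW a' s mem_N by (auto simp: doubleton_eq_iff)
      qed
      moreover have "v \<noteq> x"
      proof
        assume "v = x"
        then have "N x \<subseteq> {a}" using calculation(2) by simp
        then have "card (N x) \<le> card {a}" by (rule card_mono[rotated]) simp
        then show False using x by simp
      qed
      ultimately show "v \<in> undominated \<gamma> n E - {p, q}" using vW pq by (simp add: undE)
    qed
    ultimately show ?thesis by blast
  qed
  consider (y) "y = p \<or> y = q" | (z) "z = p \<or> z = q" "y \<noteq> p" "y \<noteq> q"
    | (none) "y \<noteq> p" "y \<noteq> q" "z \<noteq> p" "z \<noteq> q" by blast
  then show ?thesis
  proof cases
    case y
    have "p = q" "y \<noteq> z" using Npq[OF yzW(1) y G(3)] by auto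
    moreover from this y have "z \<noteq> p" "z \<noteq> q" "y = p" by auto
    moreover have "card (N z) \<ge> 2" using Ncard[OF yzW(2) _ _ G(4)] calculation by simp
    ultimately show ?thesis using single[of z] d2 yzW by simp
  next
    case z
    have "p = q" "y \<noteq> z" using Npq[OF yzW(2) z(1) G(4)] by auto
    moreover from this z have "z = p" by auto
    moreover have "card (N y) \<ge> 2" using Ncard[OF yzW(1) _ _ G(3)] z by simp
    ultimately show ?thesis using single[of y] d2 yzW z by simp
  next
    case none
    have cy: "card (N y) \<ge> 2 + of_bool (y = z)" by (rule Ncard[OF yzW(1) none(1,2) G(3)])
    have cz: "card (N z) \<ge> 2 + of_bool (y = z)" by (rule Ncard[OF yzW(2) none(3,4) G(4)])
    obtain a where a: "a \<in> N y" using cy by fastforce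
    \<comment> \<open>Choosing \<open>b\<close> different from \<open>a\<close> keeps the two new
      edges distinct if \<open>p = q\<close> and the two removed ones distinct if
      \<open>y = z\<close>.\<close>
    have "\<not> N z \<subseteq> {a}" using cz card_mono[of "{a}" "N z"] by auto
    then obtain b where b: "b \<in> N z" "b \<noteq> a" by blast
    have aD: "a \<in> D" "{y, a} \<in> E2" and bD: "b \<in> D" "{z, b} \<in> E2" using a b mem_N by auto
    have pab: "p \<noteq> a" "q \<noteq> b" using aD bD pW by auto
    note m = move_edge[OF s2 aD(2) nD2(1)[OF aD(1)] pV(1) pab(1)]
    let ?F = "insert {p, a} (E2 - {{y, a}})"
    have zb: "{z, b} \<in> ?F" using bD b aD yzW by (auto simp: doubleton_eq_iff)
    have qb: "{q, b} \<notin> ?F" using nD2(2)[OF bD(1)] b pW bD by (auto simp: doubleton_eq_iff)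
    note m' = move_edge[OF m(1) zb qb pV(2) pab(2)]
    let ?F' = "insert {q, b} (?F - {{z, b}})"
    have "degree ?F' v = d v" if "v \<in> V" for v
      using m(2)[of v] m'(2)[of v] d2[OF that] deg[OF that] by linarith
    then have "realizes n ?F' d" using m'(1) by (simp add: realizes_def)
    moreover have "undominated \<gamma> n ?F' \<subseteq> undominated \<gamma> n E - {p, q}"
    proof
      fix v assume v: "v \<in> undominated \<gamma> n ?F'"
      then have vW: "v \<in> W" and vF: "\<And>s. s \<in> D \<Longrightarrow> {v, s} \<notin> ?F'" by (auto simp: undN)
      have "v \<noteq> q" using vF[OF bD(1)] by auto
      moreover have "v \<noteq> p"
        using vF[OF aD(1)] b yzW(2) aD none by (auto simp: doubleton_eq_iff)
      moreover have sub: "N v \<subseteq> (if v = y then {a} else {}) \<union> (if v = z then {b} else {})"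
      proof
        fix s assume s: "s \<in> N v"
        then have "{v, s} = {y, a} \<or> {v, s} = {z, b}" using vF[of s] mem_N[of s v] by blast
        then show "s \<in> (if v = y then {a} else {}) \<union> (if v = z then {b} else {})"
          using vW aD bD s mem_N by (auto simp: doubleton_eq_iff)
      qed
      moreover have "N v = {}"
      proof -
        have "card (N v) \<le> of_bool (v = y) + of_bool (v = z)"
          using card_mono[OF _ sub] b by (auto split: if_splits)
        then show ?thesis using cy cz fN[of v] by (cases "v = y"; cases "v = z") auto
      qed
      ultimately show "v \<in> undominated \<gamma> n E - {p, q}" using vW by (simp add: undE)
    qed
    ultimately show ?thesis by blast
  qed
qed

end

section \<open>Realizations with fewest undominated vertices\<close>

text \<open>Here \<open>m\<close> is merely a lower bound; that a realization attains it is recorded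
  in each \<open>defect\<close>, because the switches pass through several optimal
  realizations.\<close>

locale minimal_undominated = domination_conditions +
  fixes m :: nat
  assumes minimal: "\<And>F. realizes n F d \<Longrightarrow> m \<le> card (undominated \<gamma> n F)"
begin

definition defect :: "nat set set \<Rightarrow> nat \<Rightarrow> nat \<Rightarrow> bool" where
  "defect F w x \<longleftrightarrow> realizes n F d \<and> card (undominated \<gamma> n F) = m \<and>
     w \<in> undominated \<gamma> n F \<and> {w, x} \<in> F"

lemma degree_W_D:
  assumes "simple_graph V F"
  shows "degree F v = card (neighbours F v \<inter> W) + card (neighbours F v \<inter> D)"
proof -
  have "neighbours F v = (neighbours F v \<inter> W) \<union> (neighbours F v \<inter> D)"
    using neighbours_sub[OF assms, of v] V_split by blast
  then have "degree F v = card ((neighbours F v \<inter> W) \<union> (neighbours F v \<inter> D))"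
    by (simp add: degree_def)
  also have "\<dots> = card (neighbours F v \<inter> W) + card (neighbours F v \<inter> D)"
    by (rule card_Un_disjoint) (use V_split in auto)
  finally show ?thesis .
qed

lemma finite_undominated: "finite (undominated \<gamma> n F)"
  by (simp add: undominated_def)

lemma undominated_iff: "v \<in> undominated \<gamma> n F \<longleftrightarrow> v \<in> W \<and> (\<forall>a\<in>D. {a, v} \<notin> F)"
  by (simp add: undominated_def)

lemma card_less_m:
  assumes "w \<in> U" "finite U" "card U = m" "A \<subseteq> U - {w}"
  shows "card A < m"
proof -
  have "card A \<le> card (U - {w})" using assms by (intro card_mono) auto
  also have "\<dots> < card U" using assms by (intro card_Diff1_less) auto
  finally show ?thesis using assms by simp
qed

lemma no_repair:
  assumes "simple_graph V F" "\<And>v. v \<in> V \<Longrightarrow> degree F v + of_bool (v = p) + of_bool (v = q) = d v"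
    and "p \<in> undominated \<gamma> n F" "q \<in> undominated \<gamma> n F"
  shows "m \<le> card (undominated \<gamma> n F - {p, q})"
proof -
  have "\<exists>E'. realizes n E' d \<and> undominated \<gamma> n E' \<subseteq> undominated \<gamma> n F - {p, q}"
    by (rule repair[OF assms(1) _ assms(3,4)]) (rule assms(2))
  then obtain E' where E': "realizes n E' d"
    "undominated \<gamma> n E' \<subseteq> undominated \<gamma> n F - {p, q}" by blast
  have "m \<le> card (undominated \<gamma> n E')" by (rule minimal[OF E'(1)])
  also have "\<dots> \<le> card (undominated \<gamma> n F - {p, q})"
    using E'(2) finite_undominated by (intro card_mono) auto
  finally show ?thesis .
qed

context
  fixes F :: "nat set set" and w x :: nat
  assumes defect: "defect F w x"
begin

lemma defect_simple: "simple_graph V F"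
  and defect_degree: "v \<in> V \<Longrightarrow> degree F v = d v"
  and defect_card: "card (undominated \<gamma> n F) = m"
  and defect_w: "w \<in> undominated \<gamma> n F"
  and defect_edge: "{w, x} \<in> F"
  using defect by (simp_all add: defect_def realizes_def)

lemma defect_W: "w \<in> W" and defect_D: "a \<in> D \<Longrightarrow> {a, w} \<notin> F"
  using defect_w by (simp_all add: undominated_iff)

lemma defect_neighbour_W: "{w, c} \<in> F \<Longrightarrow> c \<in> W"
proof -
  assume c: "{w, c} \<in> F"
  then have "c \<in> V" using edge_in(2)[OF defect_simple] by blast
  moreover have "c \<notin> D" using defect_D[of c] c by (metis insert_commute)
  ultimately show "c \<in> W" using V_split by blast
qed

lemma defect_x: "x \<in> W" "x \<noteq> w"
  using defect_neighbour_W[OF defect_edge] edge_in(3)[OF defect_simple defect_edge] by auto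

text \<open>If \<open>x\<close> has no dominator, delete \<open>wx\<close> and repair
  \<open>w\<close> and \<open>x\<close>. If it has only \<open>a\<close>, delete \<open>wx\<close>,
  trade \<open>xa\<close> for \<open>wa\<close>, and repair \<open>x\<close>, which now lacks two
  edges. Either way \<open>w\<close> becomes dominated and no vertex newly loses domination, against
  the choice of \<open>m\<close>.\<close>

lemma defect_two_dominators: "2 \<le> card (neighbours F x \<inter> D)"
proof (rule ccontr)
  assume "\<not> ?thesis"
  then have "card (neighbours F x \<inter> D) = 0 \<or> card (neighbours F x \<inter> D) = 1" by linarith
  then consider "neighbours F x \<inter> D = {}" | a where "neighbours F x \<inter> D = {a}"
    by (auto simp: card_1_singleton_iff)
  then show False
  proof cases
    case 1
    let ?F = "F - {{w, x}}"
    have s: "simple_graph V ?F" by (rule simple_graph_diff[OF defect_simple])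
    have xD: "{a, x} \<notin> F" if "a \<in> D" for a
    proof
      assume "{a, x} \<in> F"
      then have "a \<in> neighbours F x \<inter> D" using that by (simp add: mem_neighbours)
      with 1 show False by simp
    qed
    have "degree ?F v + of_bool (v = w) + of_bool (v = x) = d v" if "v \<in> V" for v
      using degree_remove[OF defect_simple defect_edge, of v] defect_degree[OF that] by linarith
    moreover have "w \<in> undominated \<gamma> n ?F" "x \<in> undominated \<gamma> n ?F"
      using defect_W defect_D defect_x xD by (simp_all add: undominated_iff)
    ultimately have "m \<le> card (undominated \<gamma> n ?F - {w, x})" by (intro no_repair s)
    moreover have "undominated \<gamma> n ?F \<subseteq> undominated \<gamma> n F"
    proof
      fix v assume v: "v \<in> undominated \<gamma> n ?F"
      have "{a, v} \<noteq> {w, x}" if "a \<in> D" for a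
        using that defect_W defect_x by (simp add: doubleton_eq_iff)
      then show "v \<in> undominated \<gamma> n F" using v by (simp add: undominated_iff)
    qed
    then have "undominated \<gamma> n ?F - {w, x} \<subseteq> undominated \<gamma> n F - {w}" by blast
    from card_less_m[OF defect_w finite_undominated defect_card this] calculation
    show False by simp
  next
    case (2 a)
    have "a \<in> neighbours F x \<inter> D" using 2 by simp
    then have a: "a \<in> D" "{x, a} \<in> F" by (simp_all add: mem_neighbours insert_commute)
    have wx: "a \<noteq> w" "a \<noteq> x" using a defect_W defect_x by auto
    let ?K = "F - {{w, x}}"
    let ?F = "insert {w, a} (?K - {{x, a}})"
    have s0: "simple_graph V ?K" by (rule simple_graph_diff[OF defect_simple])
    have xa: "{x, a} \<in> ?K" using a wx by (simp add: doubleton_eq_iff)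
    have wa: "{w, a} \<notin> ?K" using defect_D[OF a(1)] by (simp add: insert_commute)
    have wV: "w \<in> V" using defect_W by simp
    note mv = move_edge[OF s0 xa wa wV wx(1)[symmetric]]
    have "degree ?F v + of_bool (v = x) + of_bool (v = x) = d v" if "v \<in> V" for v
      using degree_remove[OF defect_simple defect_edge, of v] defect_degree[OF that] mv(2)[of v]
      by linarith
    moreover have xF: "x \<in> undominated \<gamma> n ?F"
      unfolding undominated_iff
    proof (intro conjI ballI defect_x(1) notI)
      fix b assume b: "b \<in> D" "{b, x} \<in> ?F"
      have "{b, x} \<noteq> {w, a}" using defect_x b defect_W wx by (simp add: doubleton_eq_iff)
      then have "{b, x} \<in> F" "{b, x} \<noteq> {x, a}" using b by blast+
      then have "b \<in> neighbours F x \<inter> D" "b \<noteq> a" using b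
        by (auto simp: mem_neighbours insert_commute)
      with 2 show False by simp
    qed
    ultimately have "m \<le> card (undominated \<gamma> n ?F - {x, x})" by (intro no_repair mv(1))
    moreover have "undominated \<gamma> n ?F - {x, x} \<subseteq> undominated \<gamma> n F - {w}"
    proof
      fix v assume "v \<in> undominated \<gamma> n ?F - {x, x}"
      then have vW: "v \<in> W" "v \<noteq> x" and vF: "\<And>b. b \<in> D \<Longrightarrow> {b, v} \<notin> ?F"
        by (simp_all add: undominated_iff)
      have "{b, v} \<notin> F" if "b \<in> D" for b
      proof -
        have "{b, v} \<noteq> {w, x}" "{b, v} \<noteq> {x, a}"
          using that vW defect_W defect_x by (simp_all add: doubleton_eq_iff)
        then show ?thesis using vF[OF that] by blast
      qed
      moreover have "v \<noteq> w" using vF[OF a(1)] by (metis insertI1 insert_commute)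
      ultimately show "v \<in> undominated \<gamma> n F - {w}" using vW by (simp add: undominated_iff)
    qed
    from card_less_m[OF defect_w finite_undominated defect_card this] calculation
    show False by simp
  qed
qed

lemma realizes_switch:
  assumes "{c, b} \<in> F" "{w, c} \<notin> F" "{x, b} \<notin> F" "w \<noteq> c" "x \<noteq> b"
  shows "realizes n (switch F w x c b) d"
  using simple_graph_switch[OF defect_simple defect_edge assms]
    degree_switch[OF defect_simple defect_edge assms] defect_degree
  by (simp add: realizes_def)

text \<open>Switching \<open>wx\<close>, \<open>ab\<close> to \<open>wa\<close>, \<open>xb\<close>
  gives \<open>w\<close> a dominator. Only \<open>b\<close> can pay for this, and only if it lies in
  \<open>W\<close> and has no dominator besides \<open>a\<close>.\<close>

lemma nonneighbour_dominator:
  assumes b: "b \<noteq> x" "{b, x} \<notin> F" and a: "a \<in> D" "{a, b} \<in> F"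
  shows "b \<in> W" "neighbours F b \<inter> D = {a}"
proof -
  have "b \<noteq> w" using a defect_D by blast
  have wa: "{w, a} \<notin> F" using defect_D[OF a(1)] by (simp add: insert_commute)
  have xb: "{x, b} \<notin> F" using b by (simp add: insert_commute)
  have "w \<noteq> a" using defect_W a by auto
  let ?G = "switch F w x a b"
  have G: "realizes n ?G d"
    by (rule realizes_switch) (use a wa xb b \<open>w \<noteq> a\<close> in auto)
  have "b \<in> W \<and> neighbours F b \<inter> D = {a}"
  proof (rule ccontr)
    assume no: "\<not> ?thesis"
    have "undominated \<gamma> n ?G \<subseteq> undominated \<gamma> n F - {w}"
    proof
      fix v assume "v \<in> undominated \<gamma> n ?G"
      then have vW: "v \<in> W" and vF: "\<And>s. s \<in> D \<Longrightarrow> {s, v} \<notin> ?G"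
        by (simp_all add: undominated_iff)
      have "v \<noteq> w" using vF[OF a(1)] by (auto simp: mem_switch insert_commute)
      have s: "v = b \<and> s = a" if "s \<in> D" "{s, v} \<in> F" for s
      proof -
        have "{s, v} \<noteq> {w, x}" using that vW defect_W defect_x by (simp add: doubleton_eq_iff)
        then have "{s, v} = {a, b}" using vF[OF that(1)] that(2) unfolding mem_switch by blast
        then show ?thesis using a vW that by (auto simp: doubleton_eq_iff)
      qed
      have "{s, v} \<notin> F" if "s \<in> D" for s
      proof
        assume "{s, v} \<in> F"
        from s[OF that this] have "v = b" by simp
        then have "neighbours F b \<inter> D \<subseteq> {a}" using s by (auto simp: mem_neighbours)
        moreover have "a \<in> neighbours F b \<inter> D" using a by (simp add: mem_neighbours)
        ultimately have "neighbours F b \<inter> D = {a}" by blast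
        with no vW \<open>v = b\<close> show False by simp
      qed
      with vW \<open>v \<noteq> w\<close> show "v \<in> undominated \<gamma> n F - {w}" by (simp add: undominated_iff)
    qed
    from card_less_m[OF defect_w finite_undominated defect_card this] minimal[OF G]
    show False by simp
  qed
  then show "b \<in> W" "neighbours F b \<inter> D = {a}" by auto
qed

text \<open>The vertex \<open>w\<close> gives up \<open>x\<close> for \<open>c\<close> and stays
  undominated, so \<open>c\<close> becomes a far end. If \<open>b\<close> lies in \<open>D\<close>,
  then \<open>c\<close> could lose its last dominator; but then \<open>wc\<close> would join two
  undominated vertices, and deleting it and repairing both would beat \<open>m\<close>.\<close>

lemma defect_switch:
  assumes b: "b \<noteq> x" "{b, x} \<notin> F" and c: "{c, b} \<in> F" "c \<in> W" "c \<noteq> w" "{c, w} \<notin> F"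
  shows "defect (switch F w x c b) w c"
proof -
  have wc: "{w, c} \<notin> F" and xb: "{x, b} \<notin> F" using b c by (simp_all add: insert_commute)
  have bw: "b \<noteq> w" using c by blast
  let ?G = "switch F w x c b"
  have G: "realizes n ?G d"
    by (rule realizes_switch) (use b c wc xb in auto)
  have sG: "simple_graph V ?G" and dG: "\<And>v. v \<in> V \<Longrightarrow> degree ?G v = d v"
    using G by (simp_all add: realizes_def)
  have wcG: "{w, c} \<in> ?G" by (simp add: mem_switch)
  have old: "{s, v} \<in> F \<Longrightarrow> s \<in> D \<Longrightarrow> v \<in> W \<Longrightarrow> {s, v} \<in> ?G \<or> v = c \<and> s = b" for s v
  proof -
    assume s: "{s, v} \<in> F" "s \<in> D" "v \<in> W"
    have "{s, v} \<noteq> {w, x}" using s defect_W defect_x by (simp add: doubleton_eq_iff)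
    then have "{s, v} \<in> ?G \<or> {s, v} = {c, b}" using s unfolding mem_switch by blast
    then show ?thesis using s c by (auto simp: doubleton_eq_iff)
  qed
  have wG: "w \<in> undominated \<gamma> n ?G"
    unfolding undominated_iff
  proof (intro conjI ballI defect_W notI)
    fix s assume s: "s \<in> D" "{s, w} \<in> ?G"
    then have "{s, w} = {w, c} \<or> {s, w} = {x, b}" using defect_D[OF s(1)] unfolding mem_switch by blast
    then show False using s c bw defect_x by (auto simp: doubleton_eq_iff)
  qed
  have sub: "undominated \<gamma> n ?G \<subseteq> insert c (undominated \<gamma> n F)"
  proof
    fix v assume "v \<in> undominated \<gamma> n ?G"
    then have vW: "v \<in> W" and vF: "\<And>s. s \<in> D \<Longrightarrow> {s, v} \<notin> ?G"
      by (simp_all add: undominated_iff)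
    show "v \<in> insert c (undominated \<gamma> n F)"
    proof (cases "v = c")
      case False
      then have "{s, v} \<notin> F" if "s \<in> D" for s using old[OF _ that vW] vF[OF that] by blast
      then show ?thesis using vW by (simp add: undominated_iff)
    qed simp
  qed
  have cF: "c \<in> undominated \<gamma> n F" if cG: "c \<in> undominated \<gamma> n ?G"
  proof (rule ccontr)
    assume "c \<notin> undominated \<gamma> n F"
    let ?F = "?G - {{w, c}}"
    have "degree ?F v + of_bool (v = w) + of_bool (v = c) = d v" if "v \<in> V" for v
      using degree_remove[OF sG wcG, of v] dG[OF that] by linarith
    moreover have "w \<in> undominated \<gamma> n ?F" "c \<in> undominated \<gamma> n ?F"
      using wG cG by (simp_all add: undominated_iff)
    ultimately have "m \<le> card (undominated \<gamma> n ?F - {w, c})"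
      by (intro no_repair simple_graph_diff[OF sG])
    moreover have "undominated \<gamma> n ?F \<subseteq> undominated \<gamma> n ?G"
    proof
      fix v assume v: "v \<in> undominated \<gamma> n ?F"
      have "{a, v} \<noteq> {w, c}" if "a \<in> D" for a
        using that defect_W c by (simp add: doubleton_eq_iff)
      then show "v \<in> undominated \<gamma> n ?G" using v by (simp add: undominated_iff)
    qed
    then have "undominated \<gamma> n ?F - {w, c} \<subseteq> undominated \<gamma> n F - {w}" using sub by blast
    from card_less_m[OF defect_w finite_undominated defect_card this] calculation
    show False by simp
  qed
  then have "undominated \<gamma> n ?G \<subseteq> undominated \<gamma> n F" using sub by blast
  then have "card (undominated \<gamma> n ?G) \<le> m"
    using card_mono[OF finite_undominated] defect_card by metis
  then show ?thesis using minimal[OF G] G wG wcG by (simp add: defect_def)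
qed

end

end

lemma card_ge_2_ex: "2 \<le> card A \<Longrightarrow> \<exists>a. a \<in> A"
  by (cases "A = {}") auto

section \<open>The extremal edge: structure around the largest far end \<open>r\<close>\<close>

context minimal_undominated
begin

context
  fixes G :: "nat set set" and w r :: nat
  assumes def: "defect G w r" and last: "\<And>F u x. defect F u x \<Longrightarrow> x \<le> r"
begin

abbreviation "S \<equiv> {\<gamma>+1..r}"
abbreviation "T \<equiv> {r+1..n}"

lemma r_bounds: "\<gamma> < r" "r \<le> n"
  using defect_x[OF def] by auto

lemma S_W: "s \<in> S \<Longrightarrow> s \<in> W" "s \<in> S \<Longrightarrow> s \<in> V"
  using r_bounds by auto

lemma degree_ge: "s \<in> S \<Longrightarrow> degree G r \<le> degree G s"
  using noninc[of s r] S_W[of s] r_bounds defect_degree[OF def] by simp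

lemma defect_neighbour_S:
  assumes "defect F u x" "{u, c} \<in> F"
  shows "c \<in> S"
proof -
  have "defect F u c" using assms by (simp add: defect_def)
  then show ?thesis using last[of F u c] defect_x(1)[of F u c] by simp
qed

text \<open>Either \<open>c\<close> is already a neighbour of \<open>u\<close>, or one switch makes
  it one; maximality of \<open>r\<close> applies in both cases.\<close>

lemma nonneighbour_neighbours:
  assumes df: "defect F u x" and b: "b \<noteq> x" "{b, x} \<notin> F" "b \<noteq> u"
    and c: "{c, b} \<in> F" "c \<in> W" "c \<noteq> u"
  shows "c \<in> S"
proof (cases "{u, c} \<in> F")
  case True
  then show ?thesis using defect_neighbour_S[OF df] by blast
next
  case False
  then have "{c, u} \<notin> F" by (simp add: insert_commute)
  from last[OF defect_switch[OF df b(1,2) c this]] c(2) show ?thesis by simp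
qed

text \<open>Otherwise \<open>w\<close> has degree at least that of \<open>r\<close> but no
  dominator, while \<open>r\<close> has two. So \<open>w\<close> has a neighbour \<open>z\<close> in
  \<open>W\<close> not adjacent to \<open>r\<close>. As a neighbour of \<open>w\<close> it has two
  dominators, as a non-neighbour of \<open>r\<close> at most one.\<close>

lemma w_not_S: "w \<notin> S"
proof
  assume wS: "w \<in> S"
  have "neighbours G w \<inter> W = neighbours G w"
    using defect_neighbour_W[OF def] by (auto simp: mem_neighbours insert_commute)
  then have dw: "degree G w = card (neighbours G w \<inter> W)" by (simp add: degree_def)
  have dr: "degree G r = card (neighbours G r \<inter> W) + card (neighbours G r \<inter> D)"
    using degree_W_D[OF defect_simple[OF def]] .
  have "card (neighbours G r \<inter> W) < card (neighbours G w \<inter> W)"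
    using degree_ge[OF wS] dw dr defect_two_dominators[OF def] by linarith
  then obtain z where z: "z \<in> W" "{z, w} \<in> G" "{z, r} \<notin> G" "z \<noteq> r"
    using ex_neighbour_diff[OF defect_simple[OF def], of r W w] defect_W[OF def] defect_x(1)[OF def]
    by metis
  have "defect G w z" using def z(2) by (simp add: defect_def insert_commute)
  then have "2 \<le> card (neighbours G z \<inter> D)" by (rule defect_two_dominators)
  moreover obtain a where "a \<in> neighbours G z \<inter> D"
    using card_ge_2_ex[OF calculation] by blast
  then have "a \<in> D" "{a, z} \<in> G" by (simp_all add: mem_neighbours)
  from nonneighbour_dominator(2)[OF def z(4,3) this] have "card (neighbours G z \<inter> D) = 1" by simp
  ultimately show False by simp
qed

text \<open>Every vertex of \<open>S\<close> can be given the role of \<open>r\<close>, at the cost of one switch.\<close>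

lemma defect_at:
  assumes i: "i \<in> S"
  obtains "defect G w i"
  | z where "{w, i} \<notin> G" "{z, i} \<in> G" "{z, r} \<notin> G" "z \<noteq> r" "z \<noteq> i" "z \<noteq> w" "i \<noteq> r"
      "defect (switch G w r i z) w i"
proof (cases "{w, i} \<in> G")
  case True
  then show ?thesis using that(1) def by (simp add: defect_def)
next
  case False
  have iw: "i \<noteq> w" using i w_not_S by blast
  have ir: "i \<noteq> r" using False defect_edge[OF def] by blast
  have sG: "simple_graph V G" by (rule defect_simple[OF def])
  \<comment> \<open>Leaving out \<open>w\<close>, a neighbour of \<open>r\<close> but not of
    \<open>i\<close>, makes the comparison strict even when both degrees agree.\<close>
  have "card (neighbours G r \<inter> (- {w})) < card (neighbours G i \<inter> (- {w}))"
  proof -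
    have "w \<in> neighbours G r" using defect_edge[OF def] by (simp add: mem_neighbours)
    moreover have "neighbours G r \<inter> - {w} = neighbours G r - {w}" by blast
    ultimately have "card (neighbours G r \<inter> - {w}) < degree G r"
      using finite_neighbours[OF sG] by (simp add: degree_def card_Diff1_less del: card_Diff_insert)
    moreover have "neighbours G i \<inter> - {w} = neighbours G i"
      using False by (auto simp: mem_neighbours)
    ultimately show ?thesis using degree_ge[OF i] by (simp add: degree_def)
  qed
  then obtain z where z: "z \<in> - {w}" "{z, i} \<in> G" "{z, r} \<notin> G" "z \<noteq> r" "z \<noteq> i"
    using ex_neighbour_diff[OF sG, of r "- {w}" i] iw defect_x(2)[OF def] by blast
  have "{i, z} \<in> G" "{i, w} \<notin> G" using z False by (simp_all add: insert_commute)
  from defect_switch[OF def z(4,3) this(1) S_W(1)[OF i] iw this(2)]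
  show ?thesis using that(2)[of z] z False ir by simp
qed

text \<open>With fewer dominators than \<open>r\<close> and no smaller degree, \<open>i\<close> has
  more neighbours in \<open>W\<close>, so \<open>z\<close> can be chosen in \<open>W\<close>. The
  switch that makes \<open>i\<close> a far end then touches no edge from \<open>i\<close> to
  \<open>D\<close>, and the bound for far ends carries back to \<open>G\<close>.\<close>

lemma S_two_dominators:
  assumes i: "i \<in> S"
  shows "2 \<le> card (neighbours G i \<inter> D)"
proof (rule ccontr)
  assume less: "\<not> ?thesis"
  have sG: "simple_graph V G" by (rule defect_simple[OF def])
  have iw: "i \<noteq> w" using i w_not_S by blast
  have wi: "{w, i} \<notin> G"
  proof
    assume "{w, i} \<in> G"
    then have "defect G w i" using def by (simp add: defect_def)
    from defect_two_dominators[OF this] less show False by simp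
  qed
  have ir: "i \<noteq> r" using wi defect_edge[OF def] by blast
  have "degree G i = card (neighbours G i \<inter> W) + card (neighbours G i \<inter> D)"
    "degree G r = card (neighbours G r \<inter> W) + card (neighbours G r \<inter> D)"
    using degree_W_D[OF sG] by blast+
  then have "card (neighbours G r \<inter> W) < card (neighbours G i \<inter> W)"
    using degree_ge[OF i] less defect_two_dominators[OF def] by linarith
  then obtain z where z: "z \<in> W" "{z, i} \<in> G" "{z, r} \<notin> G" "z \<noteq> r" "z \<noteq> i"
    using ex_neighbour_diff[OF sG, of r W i] S_W(1)[OF i] defect_x(1)[OF def] by metis
  have iz: "{i, z} \<in> G" "{i, w} \<notin> G" using z wi by (simp_all add: insert_commute)
  let ?H = "switch G w r i z"
  have "defect ?H w i" by (rule defect_switch[OF def z(4,3) iz(1) S_W(1)[OF i] iw iz(2)])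
  then have "2 \<le> card (neighbours ?H i \<inter> D)" by (rule defect_two_dominators)
  moreover have "neighbours ?H i \<inter> D = neighbours G i \<inter> D"
  proof -
    have "{a, i} \<in> ?H \<longleftrightarrow> {a, i} \<in> G" if "a \<in> D" for a
      using that S_W(1)[OF i] z(1) defect_W[OF def] defect_x(1)[OF def]
      unfolding mem_switch by (auto simp: doubleton_eq_iff)
    then show ?thesis by (auto simp: mem_neighbours)
  qed
  ultimately show False using less by simp
qed

text \<open>A vertex not adjacent to the far end \<open>i\<close> has at most one dominator, but
  \<open>j\<close> has two. If a switch is needed to make \<open>i\<close> a far end,
  \<open>j\<close> differs from \<open>z\<close>, so it keeps its dominators and remains nonadjacent
  to \<open>i\<close>.\<close>

lemma S_clique:
  assumes i: "i \<in> S" and j: "j \<in> S" and ij: "i \<noteq> j"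
  shows "{j, i} \<in> G"
proof (rule ccontr)
  assume nij: "{j, i} \<notin> G"
  have many: "\<exists>a\<in>D. {a, k} \<in> F \<and> neighbours F k \<inter> D \<noteq> {a}"
    if two: "2 \<le> card (neighbours F k \<inter> D)" for F k
  proof -
    obtain a where "a \<in> neighbours F k \<inter> D" using card_ge_2_ex[OF two] by blast
    then show ?thesis using two by (intro bexI[of _ a]) (auto simp: mem_neighbours)
  qed
  have jw: "j \<noteq> w" using j w_not_S by blast
  show False
  proof (cases rule: defect_at[OF i])
    case 1
    obtain a where "a \<in> D" "{a, j} \<in> G" "neighbours G j \<inter> D \<noteq> {a}"
      using many[OF S_two_dominators[OF j]] by blast
    then show False using nonneighbour_dominator(2)[OF 1 ij[symmetric] nij] by blast
  next
    case (2 z)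
    let ?H = "switch G w r i z"
    have jz: "j \<noteq> z" using nij 2 by blast
    have "neighbours G j \<inter> D \<subseteq> neighbours ?H j \<inter> D"
    proof
      fix a assume a: "a \<in> neighbours G j \<inter> D"
      then have "{a, j} \<noteq> {w, r}" "{a, j} \<noteq> {i, z}"
        using defect_W[OF def] defect_x(1)[OF def] jz ij by (auto simp: doubleton_eq_iff)
      then show "a \<in> neighbours ?H j \<inter> D" using a by (simp add: mem_neighbours mem_switch)
    qed
    then have "card (neighbours G j \<inter> D) \<le> card (neighbours ?H j \<inter> D)"
      by (intro card_mono) auto
    then have "2 \<le> card (neighbours ?H j \<inter> D)" using S_two_dominators[OF j] by simp
    from many[OF this] obtain a where "a \<in> D" "{a, j} \<in> ?H" "neighbours ?H j \<inter> D \<noteq> {a}" by blast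
    moreover have "{j, i} \<notin> ?H"
      using nij 2 ij jw jz unfolding mem_switch by (auto simp: doubleton_eq_iff)
    ultimately show False using nonneighbour_dominator(2)[OF 2(8) ij[symmetric]] by blast
  qed
qed

lemma switch_neighbours:
  assumes "v \<notin> {a, b, c, e}"
  shows "{u, v} \<in> switch F a b c e \<longleftrightarrow> {u, v} \<in> F"
  using assms by (auto simp: mem_switch doubleton_eq_iff)

text \<open>The switch that makes \<open>s\<close> a far end leaves all edges at \<open>b\<close>
  alone: \<open>b\<close> is neither \<open>w\<close> nor in \<open>S\<close>, and it is not
  \<open>z\<close>, which is adjacent to \<open>s\<close>.\<close>

lemma neighbours_outside:
  assumes s: "s \<in> S" and b: "b \<notin> S" "b \<noteq> w" "{b, s} \<notin> G" and c: "{c, b} \<in> G" "c \<in> W"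
  shows "c \<in> S"
proof (cases rule: defect_at[OF s])
  case 1
  have "c \<noteq> w" using defect_neighbour_S[OF def, of b] b(1) c by blast
  then show ?thesis using nonneighbour_neighbours[OF 1 _ b(3,2) c] b s by blast
next
  case (2 z)
  let ?H = "switch G w r s z"
  have cw: "c \<noteq> w" using defect_neighbour_S[OF def, of b] b(1) c by blast
  have "r \<in> S" using r_bounds by simp
  then have "b \<notin> {w, r, s, z}" using 2(2) b s by auto
  then have "{u, b} \<in> ?H \<longleftrightarrow> {u, b} \<in> G" for u by (rule switch_neighbours)
  from this[of s] this[of c] have "{b, s} \<notin> ?H" "{c, b} \<in> ?H"
    using b c by (simp_all add: insert_commute)
  moreover have "b \<noteq> s" using b s by blast
  ultimately show ?thesis using nonneighbour_neighbours[OF 2(8) _ _ b(2) _ c(2) cw] by blast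
qed

lemma dominators_outside:
  assumes s: "s \<in> S" and b: "b \<notin> S" "b \<noteq> w" "{b, s} \<notin> G" and a: "a \<in> D" "{a, b} \<in> G"
  shows "b \<in> W \<and> neighbours G b \<inter> D = {a}"
proof (cases rule: defect_at[OF s])
  case 1
  then show ?thesis using nonneighbour_dominator[OF 1 _ b(3) a] b s by blast
next
  case (2 z)
  let ?H = "switch G w r s z"
  have "r \<in> S" using r_bounds by simp
  then have "b \<notin> {w, r, s, z}" using 2(2) b s by auto
  then have eq: "{u, b} \<in> ?H \<longleftrightarrow> {u, b} \<in> G" for u by (rule switch_neighbours)
  from this[of s] this[of a] have "{b, s} \<notin> ?H" "{a, b} \<in> ?H"
    using b a by (simp_all add: insert_commute)
  moreover have "b \<noteq> s" using b s by blast
  moreover have "neighbours ?H b = neighbours G b" using eq by (auto simp: mem_neighbours)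
  ultimately show ?thesis using nonneighbour_dominator[OF 2(8) _ _ a(1), of b] by simp
qed

text \<open>The number \<open>?N v\<close> of neighbours in \<open>S\<close> is bounded from below:
  \<open>k - 1\<close> on the clique, and otherwise \<open>k\<close> unless a neighbour in
  \<open>S\<close> is missing. In that case nothing escapes from \<open>S\<close> at a vertex of
  \<open>D\<close>, and at most one edge, to a dominator, at a vertex of \<open>T\<close>.\<close>

lemma violates:
  fixes k :: nat
  defines "k \<equiv> r - \<gamma>"
  shows "k \<le> d 1"
    and "int k * (int k - 1) + (\<Sum>i=1..\<gamma>. min (int k) (int (d i)))
         + (\<Sum>i=\<gamma>+k+1..n. min (int k) (int (d i) - 1)) < (\<Sum>i=\<gamma>+1..min n (\<gamma>+k). int (d i))"
proof -
  have sG: "simple_graph V G" by (rule defect_simple[OF def])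
  have k: "\<gamma> + k = r" "card S = k" "1 \<le> k" using r_bounds by (auto simp: k_def)
  have rS: "r \<in> S" using r_bounds by simp
  let ?N = "\<lambda>v. card (neighbours G v \<inter> S)"
  have NS: "?N s = k - 1" if "s \<in> S" for s
  proof -
    have "neighbours G s \<inter> S = S - {s}"
      using S_clique[OF that] neighbours_sub[OF sG, of s] by (auto simp: mem_neighbours)
    then show ?thesis using that k by simp
  qed
  have Nle: "?N v \<le> degree G v" for v
    unfolding degree_def using finite_neighbours[OF sG] by (intro card_mono) auto
  have full: "?N v = k" if "\<And>s. s \<in> S \<Longrightarrow> {v, s} \<in> G" for v
  proof -
    have "neighbours G v \<inter> S = S" using that by (auto simp: mem_neighbours insert_commute)
    then show ?thesis using k by simp
  qed
  have ND: "min k (d a) \<le> ?N a" if a: "a \<in> D" for a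
  proof (cases "\<forall>s\<in>S. {a, s} \<in> G")
    case True
    then show ?thesis using full[of a] by simp
  next
    case False
    then obtain s where s: "s \<in> S" "{a, s} \<notin> G" by blast
    have a': "a \<notin> S" "a \<noteq> w" "a \<notin> W" "a \<in> V" using a defect_W[OF def] gamma by auto
    have "c \<in> S" if c: "{c, a} \<in> G" for c
    proof (rule neighbours_outside[OF s(1) a'(1,2) s(2) c])
      \<comment> \<open>An edge inside \<open>D\<close> at \<open>a\<close> would, by
        \<open>dominators_outside\<close>, place \<open>a\<close> in \<open>W\<close>.\<close>
      have "c \<notin> D" using dominators_outside[OF s(1) a'(1,2) s(2) _ c] a' by blast
      then show "c \<in> W" using edge_in(1)[OF sG c] V_split by blast
    qed
    then have "neighbours G a \<inter> S = neighbours G a" by (auto simp: mem_neighbours)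
    then show ?thesis using defect_degree[OF def a'(4)] by (simp add: degree_def)
  qed
  have Nw: "?N w = d w"
  proof -
    have "neighbours G w \<inter> S = neighbours G w"
      using defect_neighbour_S[OF def] by (auto simp: mem_neighbours insert_commute)
    then show ?thesis using defect_degree[OF def, of w] defect_W[OF def] by (simp add: degree_def)
  qed
  have NT: "min k (d v - 1) \<le> ?N v" if v: "v \<in> T" for v
  proof -
    have v': "v \<notin> S" "v \<in> V" "v \<in> W" using v r_bounds by auto
    consider "v = w" | "\<forall>s\<in>S. {v, s} \<in> G" | s where "v \<noteq> w" "s \<in> S" "{v, s} \<notin> G" by blast
    then show ?thesis
    proof cases
      case 1 then show ?thesis using Nw by simp
    next
      case 2 then show ?thesis using full[of v] by simp
    next
      case (3 s)
      have "neighbours G v \<inter> W \<subseteq> S"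
        using neighbours_outside[OF 3(2) v'(1) 3(1,3)] by (auto simp: mem_neighbours)
      then have "neighbours G v \<inter> W = neighbours G v \<inter> S" using r_bounds by auto
      moreover have "card (neighbours G v \<inter> D) \<le> 1"
      proof (cases "neighbours G v \<inter> D = {}")
        case False
        then obtain a where "a \<in> neighbours G v \<inter> D" by blast
        then have "a \<in> D" "{a, v} \<in> G" by (simp_all add: mem_neighbours)
        then show ?thesis using dominators_outside[OF 3(2) v'(1) 3(1,3)] by simp
      qed simp
      ultimately have "degree G v \<le> ?N v + 1" using degree_W_D[OF sG, of v] by simp
      then show ?thesis using defect_degree[OF def v'(2)] by simp
    qed
  qed
  have wT: "w \<in> T" using w_not_S defect_W[OF def] by auto
  \<comment> \<open>All \<open>d w\<close> edges of \<open>w\<close> end in \<open>S\<close>, one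
    more than the right side of (3) can credit to it.\<close>
  have "min k (d w - 1) < ?N w"
    using Nw pos[of w] defect_W[OF def] by simp
  then have T: "(\<Sum>v\<in>T. min k (d v - 1)) < (\<Sum>v\<in>T. ?N v)"
    using NT wT by (intro sum_strict_mono_ex1) auto
  have "(\<Sum>v\<in>S. d v) = (\<Sum>v\<in>S. degree G v)"
    using defect_degree[OF def S_W(2)] by (intro sum.cong) auto
  also have "\<dots> = (\<Sum>v\<in>V. ?N v)"
    by (rule sum_degree_eq_V[OF sG]) (use S_W in auto)
  also have "\<dots> = (\<Sum>v\<in>D. ?N v) + ((\<Sum>v\<in>S. ?N v) + (\<Sum>v\<in>T. ?N v))"
  proof -
    have "W = S \<union> T" using r_bounds by auto
    then have "(\<Sum>v\<in>W. ?N v) = (\<Sum>v\<in>S. ?N v) + (\<Sum>v\<in>T. ?N v)"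
      by (simp add: sum.union_disjoint)
    then show ?thesis unfolding sum_V by simp
  qed
  also have "(\<Sum>v\<in>S. ?N v) = k * (k - 1)" using NS k by simp
  finally have "(\<Sum>v\<in>D. min k (d v)) + k * (k - 1) + (\<Sum>v\<in>T. min k (d v - 1)) < (\<Sum>v\<in>S. d v)"
    using T sum_mono[of D "\<lambda>v. min k (d v)" ?N] ND by fastforce
  then have "int ((\<Sum>v\<in>D. min k (d v)) + k * (k - 1) + (\<Sum>v\<in>T. min k (d v - 1)))
      < int (\<Sum>v\<in>S. d v)"
    by (simp only: of_nat_less_iff)
  moreover have "int (k * (k - 1)) = int k * (int k - 1)" using k by (simp add: of_nat_diff)
  moreover have "int (\<Sum>v\<in>T. min k (d v - 1)) = (\<Sum>v\<in>T. min (int k) (int (d v) - 1))"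
    unfolding of_nat_sum
  proof (rule sum.cong[OF refl])
    fix v assume "v \<in> T"
    then have "1 \<le> d v" using pos[of v] r_bounds by simp
    then show "int (min k (d v - 1)) = min (int k) (int (d v) - 1)" by (simp add: of_nat_min of_nat_diff)
  qed
  moreover have "int (\<Sum>v\<in>D. min k (d v)) = (\<Sum>v\<in>D. min (int k) (int (d v)))"
    by (simp add: of_nat_min)
  moreover have "int (\<Sum>v\<in>S. d v) = (\<Sum>v\<in>S. int (d v))" by (rule of_nat_sum)
  moreover have min: "min n r = r" using r_bounds by simp
  ultimately show "int k * (int k - 1) + (\<Sum>i=1..\<gamma>. min (int k) (int (d i)))
         + (\<Sum>i=\<gamma>+k+1..n. min (int k) (int (d i) - 1)) < (\<Sum>i=\<gamma>+1..min n (\<gamma>+k). int (d i))"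
    unfolding k(1) min of_nat_add by linarith
  \<comment> \<open>This verifies that (3) is available for this \<open>k\<close>: besides its
    \<open>k - 1\<close> neighbours in \<open>S\<close>, the vertex \<open>r\<close> has two in
    \<open>D\<close>.\<close>
  have "neighbours G r \<inter> S \<subseteq> neighbours G r \<inter> W" using r_bounds by auto
  then have "k - 1 \<le> card (neighbours G r \<inter> W)"
    using NS[OF rS] card_mono[of "neighbours G r \<inter> W" "neighbours G r \<inter> S"] by simp
  then have "k \<le> degree G r"
    using degree_W_D[OF sG, of r] defect_two_dominators[OF def] by simp
  then show "k \<le> d 1"
    using defect_degree[OF def, of r] noninc[of 1 r] r_bounds by simp
qed

end

end

text \<open>Since degrees are positive, an undominated vertex has some edge, so far ends exist; they
  are bounded by \<open>n\<close>, which makes \<open>r\<close> well defined.\<close>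

lemma (in domination_conditions) dominated_realization:
  assumes "realizes n E d"
    and c3: "\<And>k. k \<le> d 1 \<Longrightarrow> (\<Sum>i=\<gamma>+1..min n (\<gamma>+k). int (d i))
         \<le> int k * (int k - 1) + (\<Sum>i=1..\<gamma>. min (int k) (int (d i)))
           + (\<Sum>i=\<gamma>+k+1..n. min (int k) (int (d i) - 1))"
  shows "\<exists>F. realizes n F d \<and> undominated \<gamma> n F = {}"
proof -
  define m where "m = (LEAST m. \<exists>F. realizes n F d \<and> card (undominated \<gamma> n F) = m)"
  have ex: "\<exists>m F. realizes n F d \<and> card (undominated \<gamma> n F) = m" using assms(1) by blast
  obtain F where F: "realizes n F d" "card (undominated \<gamma> n F) = m"
    using LeastI_ex[OF ex] unfolding m_def by blast
  have min: "m \<le> card (undominated \<gamma> n F')" if "realizes n F' d" for F'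
    unfolding m_def using that by (intro Least_le) blast
  interpret minimal_undominated n \<gamma> d m by unfold_locales (rule min)
  have "undominated \<gamma> n F = {}"
  proof (rule ccontr)
    assume "undominated \<gamma> n F \<noteq> {}"
    then obtain w where w: "w \<in> undominated \<gamma> n F" by blast
    then have wV: "w \<in> V" by (auto simp: undominated_def)
    then have "degree F w > 0" using F(1) pos[of w] by (simp add: realizes_def)
    then have "neighbours F w \<noteq> {}" by (auto simp: degree_def)
    then obtain x where "{w, x} \<in> F" by (auto simp: mem_neighbours insert_commute)
    then have "defect F w x" using F w by (simp add: defect_def)
    then have e: "\<exists>F w. defect F w x" by blast
    have bd: "\<forall>y. (\<exists>F w. defect F w y) \<longrightarrow> y \<le> n"
    proof (intro allI impI)
      fix y assume "\<exists>F w. defect F w y"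
      then obtain F w where "defect F w y" by blast
      from defect_x(1)[OF this] show "y \<le> n" by simp
    qed
    define r where "r = (GREATEST y. \<exists>F w. defect F w y)"
    have "\<exists>F w. defect F w r" unfolding r_def
      by (rule GreatestI_nat[where P = "\<lambda>y. \<exists>F w. defect F w y" and b = n and k = x])
        (use e bd in blast)+
    then obtain G u where def: "defect G u r" by blast
    have last: "y \<le> r" if "defect F' u' y" for F' u' y
      unfolding r_def
      by (rule Greatest_le_nat[where P = "\<lambda>y. \<exists>F w. defect F w y" and b = n])
        (use bd that in blast)+
    show False using c3[OF violates(1)[OF def]] violates(2)[OF def] last by fastforce
  qed
  with F(1) show ?thesis by blast
qed

section \<open>Necessity\<close>

text \<open>Several switches at \<open>u\<close> and \<open>v\<close> at once: each member of
  \<open>X\<close> or \<open>Y\<close> trades one of \<open>u\<close>, \<open>v\<close> for the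
  other, and \<open>card X = card Y\<close> balances \<open>u\<close> and \<open>v\<close>
  themselves.\<close>

lemma exchange_neighbours:
  assumes sg: "simple_graph V E" and uv: "u \<in> V" "v \<in> V" "u \<noteq> v"
    and X: "X \<subseteq> neighbours E u - neighbours E v - {v}"
    and Y: "Y \<subseteq> neighbours E v - neighbours E u - {u}"
    and card: "card X = card Y"
  obtains E' where "simple_graph V E'" "\<And>x. degree E' x = degree E x"
    "neighbours E' u = neighbours E u - X \<union> Y" "neighbours E' v = neighbours E v - Y \<union> X"
    "\<And>s x. {s, x} \<in> E \<Longrightarrow> s \<noteq> u \<Longrightarrow> s \<noteq> v \<Longrightarrow> x \<noteq> u \<Longrightarrow> x \<noteq> v \<Longrightarrow> {s, x} \<in> E'"
proof -
  define E' where "E' = E - ((\<lambda>z. {z, u}) ` X \<union> (\<lambda>z. {z, v}) ` Y)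
    \<union> ((\<lambda>z. {z, v}) ` X \<union> (\<lambda>z. {z, u}) ` Y)"
  have XE: "{z, u} \<in> E" "{z, v} \<notin> E" "z \<noteq> u" "z \<noteq> v" "z \<in> V" if "z \<in> X" for z
    using X that edge_in[OF sg, of z u] by (auto simp: mem_neighbours)
  have YE: "{z, v} \<in> E" "{z, u} \<notin> E" "z \<noteq> u" "z \<noteq> v" "z \<in> V" if "z \<in> Y" for z
    using Y that edge_in[OF sg, of z v] by (auto simp: mem_neighbours)
  have nin: "u \<notin> X" "v \<notin> X" "u \<notin> Y" "v \<notin> Y" using XE YE by blast+
  have XY: "X \<inter> Y = {}" using XE YE by blast
  have fin: "finite (neighbours E x)" for x by (rule finite_neighbours[OF sg])
  have finXY: "finite X" "finite Y" using X Y fin finite_subset by blast+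
  have mem: "{s, x} \<in> E' \<longleftrightarrow> {s, x} \<in> E \<and> \<not> (s = u \<and> x \<in> X \<or> x = u \<and> s \<in> X \<or> s = v \<and> x \<in> Y \<or> x = v \<and> s \<in> Y)
      \<or> (s = v \<and> x \<in> X \<or> x = v \<and> s \<in> X \<or> s = u \<and> x \<in> Y \<or> x = u \<and> s \<in> Y)" for s x
    unfolding E'_def by (auto simp: doubleton_eq_iff image_iff)
  have nu: "neighbours E' u = neighbours E u - X \<union> Y"
    using XE YE nin uv by (auto simp: mem_neighbours mem)
  have nv: "neighbours E' v = neighbours E v - Y \<union> X"
    using XE YE nin uv by (auto simp: mem_neighbours mem)
  have nX: "neighbours E' x = insert v (neighbours E x - {u})" if "x \<in> X" for x
    using that XE XY by (auto simp: mem_neighbours mem)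
  have nY: "neighbours E' x = insert u (neighbours E x - {v})" if "x \<in> Y" for x
    using that YE XY by (auto simp: mem_neighbours mem)
  have nO: "neighbours E' x = neighbours E x" if "x \<notin> X" "x \<notin> Y" "x \<noteq> u" "x \<noteq> v" for x
    using that by (auto simp: mem_neighbours mem)
  have swap: "card (A - B \<union> C) = card A" if "finite A" "finite C" "B \<subseteq> A" "C \<inter> A = {}" "card B = card C"
    for A B C :: "'a set"
  proof -
    have "finite B" using that finite_subset by blast
    then have "card (A - B \<union> C) = (card A - card B) + card C"
      using that by (subst card_Un_disjoint) (auto simp: card_Diff_subset)
    then show ?thesis using that card_mono[of A B] by simp
  qed
  show ?thesis
  proof (rule that[OF _ _ nu nv])
    have "e \<subseteq> V \<and> card e = 2" if "e \<in> E'" for e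
      using that sg uv XE YE unfolding E'_def simple_graph_def by auto
    then show "simple_graph V E'" using sg by (auto simp: simple_graph_def)
    show "degree E' x = degree E x" for x
    proof -
      consider "x = u" | "x = v" | "x \<in> X" | "x \<in> Y" | "x \<noteq> u" "x \<noteq> v" "x \<notin> X" "x \<notin> Y" by blast
      then show ?thesis
      proof cases
        case 1
        have "card (neighbours E u - X \<union> Y) = card (neighbours E u)"
          by (rule swap) (use fin finXY X Y card in auto)
        then show ?thesis using 1 nu by (simp add: degree_def)
      next
        case 2
        have "card (neighbours E v - Y \<union> X) = card (neighbours E v)"
          by (rule swap) (use fin finXY X Y card in auto)
        then show ?thesis using 2 nv by (simp add: degree_def)
      next
        case 3
        have "card (neighbours E x - {u} \<union> {v}) = card (neighbours E x)"
          by (rule swap) (use fin XE[OF 3] in \<open>auto simp: mem_neighbours insert_commute\<close>)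
        then show ?thesis using nX[OF 3] by (simp add: degree_def)
      next
        case 4
        have "card (neighbours E x - {v} \<union> {u}) = card (neighbours E x)"
          by (rule swap) (use fin YE[OF 4] in \<open>auto simp: mem_neighbours insert_commute\<close>)
        then show ?thesis using nY[OF 4] by (simp add: degree_def)
      next
        case 5
        then show ?thesis using nO by (simp add: degree_def)
      qed
    qed
    show "{s, x} \<in> E'" if "{s, x} \<in> E" "s \<noteq> u" "s \<noteq> v" "x \<noteq> u" "x \<noteq> v" for s x
      using that by (simp add: mem)
  qed
qed

text \<open>
  The only vertex that may lose all its dominators is \<open>u\<close> itself, so a dominator \<open>z\<close> of \<open>v\<close> is among
  the vertices handed from \<open>v\<close> to \<open>u\<close>. If nothing needs to be handed over, a single switch that makes
  \<open>u\<close> and \<open>v\<close> adjacent is used; it is here that \<open>v\<close> must have maximal degree outside \<open>D\<close>.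
\<close>

lemma exchange_dominating:
  assumes sg: "simple_graph V E" and dom: "dominating_set V E D"
    and u: "u \<in> D" and v: "v \<in> V" "v \<notin> D"
    and pos: "0 < degree E u" and le: "degree E u \<le> degree E v"
    and max: "\<And>t. t \<in> V \<Longrightarrow> t \<notin> D \<Longrightarrow> degree E t \<le> degree E v"
  obtains E' where "simple_graph V E'" "\<And>x. degree E' x = degree E x"
    "dominating_set V E' (insert v (D - {u}))"
proof -
  have DV: "D \<subseteq> V" and domD: "\<And>x. x \<in> V \<Longrightarrow> x \<notin> D \<Longrightarrow> \<exists>s\<in>D. {s, x} \<in> E"
    using dom by (auto simp: dominating_set_def mem_neighbours)
  have uV: "u \<in> V" and uv: "u \<noteq> v" using u v DV by auto
  have fin: "finite (neighbours E x)" for x by (rule finite_neighbours[OF sg])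
  have dom': "dominating_set V E' (insert v (D - {u}))"
    if "\<exists>s\<in>insert v (D - {u}). {s, u} \<in> E'"
      "\<And>x. x \<in> V \<Longrightarrow> x \<notin> D \<Longrightarrow> x \<noteq> u \<Longrightarrow> x \<noteq> v \<Longrightarrow> \<exists>s\<in>insert v (D - {u}). {s, x} \<in> E'"
    for E'
    unfolding dominating_set_def
  proof (intro conjI ballI)
    show "insert v (D - {u}) \<subseteq> V" using v DV by blast
    fix x assume "x \<in> V - insert v (D - {u})"
    then show "\<exists>s\<in>insert v (D - {u}). s \<in> neighbours E' x"
      using that(1) that(2)[of x] unfolding mem_neighbours by blast
  qed
  obtain z where z: "z \<in> D" "{z, v} \<in> E" using domD[OF v] by blast
  have zv: "z \<noteq> v" using z v by blast
  define X where "X = neighbours E u - neighbours E v - {v}"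
  define Y where "Y = neighbours E v - neighbours E u - {u}"
  have finX: "finite X" and finY: "finite Y" using fin by (auto simp: X_def Y_def)
  have XY: "card X \<le> card Y"
  proof -
    have "card (neighbours E u) = card (neighbours E u \<inter> neighbours E v) + card X + of_bool (v \<in> neighbours E u)"
    proof -
      have "neighbours E u = (neighbours E u \<inter> neighbours E v) \<union> X \<union> ({v} \<inter> neighbours E u)"
        by (auto simp: X_def)
      then have "card (neighbours E u) = card ((neighbours E u \<inter> neighbours E v) \<union> X \<union> ({v} \<inter> neighbours E u))"
        by simp
      also have "\<dots> = card ((neighbours E u \<inter> neighbours E v) \<union> X) + card ({v} \<inter> neighbours E u)"
        by (rule card_Un_disjoint) (use fin finX edge_in(3)[OF sg, of v v] in \<open>auto simp: X_def mem_neighbours\<close>)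
      also have "card ((neighbours E u \<inter> neighbours E v) \<union> X) = card (neighbours E u \<inter> neighbours E v) + card X"
        by (rule card_Un_disjoint) (use fin finX in \<open>auto simp: X_def\<close>)
      finally show ?thesis by simp
    qed
    moreover have "card (neighbours E v) = card (neighbours E u \<inter> neighbours E v) + card Y + of_bool (u \<in> neighbours E v)"
    proof -
      have "neighbours E v = (neighbours E u \<inter> neighbours E v) \<union> Y \<union> ({u} \<inter> neighbours E v)"
        by (auto simp: Y_def)
      then have "card (neighbours E v) = card ((neighbours E u \<inter> neighbours E v) \<union> Y \<union> ({u} \<inter> neighbours E v))"
        by simp
      also have "\<dots> = card ((neighbours E u \<inter> neighbours E v) \<union> Y) + card ({u} \<inter> neighbours E v)"
        by (rule card_Un_disjoint) (use fin finY edge_in(3)[OF sg, of u u] in \<open>auto simp: Y_def mem_neighbours\<close>)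
      also have "card ((neighbours E u \<inter> neighbours E v) \<union> Y) = card (neighbours E u \<inter> neighbours E v) + card Y"
        by (rule card_Un_disjoint) (use fin finY in \<open>auto simp: Y_def\<close>)
      finally show ?thesis by simp
    qed
    ultimately show ?thesis
      using le neighbours_sym[of u E v] by (simp add: degree_def)
  qed
  show ?thesis
  proof (cases "{u, v} \<in> E \<or> (\<exists>s\<in>D. {s, u} \<in> E \<and> {s, v} \<in> E) \<or> X \<noteq> {}")
    case True
    \<comment> \<open>All of \<open>X\<close> goes to \<open>v\<close>, which thus takes over
      everything \<open>u\<close> dominated. In return \<open>u\<close> gets \<open>Z\<close>, with
      \<open>z\<close> in it unless \<open>u\<close> will be dominated anyway.\<close>
    have "\<exists>Z\<subseteq>Y. card Z = card X \<and> ({u, v} \<in> E \<or> (\<exists>s\<in>D. {s, u} \<in> E \<and> {s, v} \<in> E) \<or> z \<in> Z)"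
    proof (cases "{u, v} \<in> E \<or> (\<exists>s\<in>D. {s, u} \<in> E \<and> {s, v} \<in> E)")
      case True
      then show ?thesis using obtain_subset_with_card_n[OF XY] by metis
    next
      case False
      then have "X \<noteq> {}" using \<open>_ \<or> _ \<or> X \<noteq> {}\<close> by blast
      then have "1 \<le> card X" using finX by (simp add: Suc_le_eq card_gt_0_iff)
      have "z \<noteq> u" "{z, u} \<notin> E" using False z by blast+
      then have zY: "z \<in> Y" using z by (simp add: Y_def mem_neighbours)
      have "card X - 1 \<le> card (Y - {z})" using XY zY finY by simp
      then obtain Z where Z: "Z \<subseteq> Y - {z}" "card Z = card X - 1" "finite Z"
        using obtain_subset_with_card_n by metis
      then have "card (insert z Z) = card X" using \<open>1 \<le> card X\<close> by (subst card_insert_disjoint) auto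
      then show ?thesis using Z zY by (intro exI[of _ "insert z Z"]) auto
    qed
    then obtain Z where Z: "Z \<subseteq> Y" "card X = card Z"
      and key: "{u, v} \<in> E \<or> (\<exists>s\<in>D. {s, u} \<in> E \<and> {s, v} \<in> E) \<or> z \<in> Z" by metis
    obtain E' where E': "simple_graph V E'" "\<And>x. degree E' x = degree E x"
      and nu: "neighbours E' u = neighbours E u - X \<union> Z" and nv: "neighbours E' v = neighbours E v - Z \<union> X"
      and old: "\<And>s x. {s, x} \<in> E \<Longrightarrow> s \<noteq> u \<Longrightarrow> s \<noteq> v \<Longrightarrow> x \<noteq> u \<Longrightarrow> x \<noteq> v \<Longrightarrow> {s, x} \<in> E'"
      by (rule exchange_neighbours[OF sg uV v(1) uv, of X Z]) (use Z in \<open>auto simp: X_def Y_def\<close>)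
    have inu: "{s, u} \<in> E' \<longleftrightarrow> s \<in> neighbours E u - X \<union> Z" for s
      using nu by (simp flip: mem_neighbours)
    have inv: "{s, v} \<in> E' \<longleftrightarrow> s \<in> neighbours E v - Z \<union> X" for s
      using nv by (simp flip: mem_neighbours)
    show ?thesis
    proof (rule that[OF E'], rule dom')
      from key show "\<exists>s\<in>insert v (D - {u}). {s, u} \<in> E'"
      proof (elim disjE bexE conjE)
        assume "{u, v} \<in> E"
        then have "{v, u} \<in> E'" unfolding inu by (simp add: X_def mem_neighbours insert_commute)
        then show ?thesis by blast
      next
        fix s assume s: "s \<in> D" "{s, u} \<in> E" "{s, v} \<in> E"
        then have "{s, u} \<in> E'" unfolding inu by (simp add: X_def mem_neighbours)
        moreover have "s \<noteq> u" using edge_in(3)[OF sg s(2)] .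
        ultimately show ?thesis using s by blast
      next
        assume "z \<in> Z"
        then have "{z, u} \<in> E'" unfolding inu by blast
        moreover have "z \<noteq> u" using \<open>z \<in> Z\<close> Z(1) by (auto simp: Y_def)
        ultimately show ?thesis using z by blast
      qed
      fix x assume x: "x \<in> V" "x \<notin> D" "x \<noteq> u" "x \<noteq> v"
      obtain s where s: "s \<in> D" "{s, x} \<in> E" using domD[OF x(1,2)] by blast
      show "\<exists>s\<in>insert v (D - {u}). {s, x} \<in> E'"
      proof (cases "s = u")
        case False
        moreover have "s \<noteq> v" using s v by blast
        ultimately show ?thesis using old[OF s(2)] x s by blast
      next
        case True
        then have "x \<in> neighbours E u" using s by (simp add: mem_neighbours insert_commute)
        then have "x \<in> neighbours E v - Z \<union> X" using Z(1) x by (auto simp: X_def Y_def)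
        then have "{v, x} \<in> E'" using inv[of x] by (simp add: insert_commute)
        then show ?thesis by blast
      qed
    qed
  next
    case False
    then have nuv: "{u, v} \<notin> E" "{v, u} \<notin> E" and X: "X = {}"
      and none: "\<And>s. s \<in> D \<Longrightarrow> {s, u} \<in> E \<Longrightarrow> {s, v} \<notin> E"
      by (auto simp: insert_commute)
    have sub: "{x, v} \<in> E" if "{x, u} \<in> E" for x
      using that X nuv by (auto simp: X_def mem_neighbours)
    have noD: "x \<notin> D" if "{x, u} \<in> E" for x
      using that sub none by blast
    have zu: "z \<noteq> u" using z nuv by blast
    \<comment> \<open>The switch will trade \<open>vy\<close>, \<open>ut\<close> for
      \<open>vu\<close>, \<open>yt\<close>. Now \<open>v\<close> dominates \<open>u\<close>, and it
      also keeps \<open>t\<close>, but it loses \<open>y\<close>. The last conjunct ensures that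
      \<open>y\<close> does not depend on \<open>v\<close>.\<close>
    have "\<exists>t y. {t, u} \<in> E \<and> {y, v} \<in> E \<and> {y, t} \<notin> E \<and> y \<noteq> t \<and> (y \<in> D \<or> {y, u} \<notin> E \<or> {z, y} \<in> E)"
    proof (cases "\<exists>t. {t, u} \<in> E \<and> {z, t} \<notin> E")
      case True
      then obtain t where "{t, u} \<in> E" "{z, t} \<notin> E" by blast
      moreover have "z \<noteq> t" using noD[OF calculation(1)] z by blast
      ultimately show ?thesis using z by blast
    next
      case False
      have "neighbours E u \<noteq> {}" using pos by (auto simp: degree_def)
      then obtain t where t: "{t, u} \<in> E" by (auto simp: mem_neighbours)
      have tV: "t \<in> V" "t \<notin> D" using edge_in(1)[OF sg t] noD[OF t] by auto
      \<comment> \<open>The vertex \<open>t\<close> has both \<open>u\<close> and \<open>v\<close>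
        as neighbours, and neither is a neighbour of \<open>v\<close>. The inclusion would therefore
        make the degree of \<open>v\<close> smaller than that of \<open>t\<close>, against
        \<open>max\<close>.\<close>
      have "\<not> neighbours E v \<subseteq> insert t (neighbours E t - {u, v})"
      proof
        assume *: "neighbours E v \<subseteq> insert t (neighbours E t - {u, v})"
        have "card (neighbours E t - {u, v}) = card (neighbours E t) - 2"
          using t sub[OF t] uv fin by (subst card_Diff_subset) (auto simp: mem_neighbours insert_commute)
        moreover have "2 \<le> card (neighbours E t)"
          using t sub[OF t] uv fin card_mono[of "neighbours E t" "{u, v}"]
          by (simp add: mem_neighbours insert_commute)
        moreover have "card (neighbours E v) \<le> card (insert t (neighbours E t - {u, v}))"
          using * fin by (intro card_mono) auto
        moreover have "\<dots> \<le> Suc (card (neighbours E t - {u, v}))"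
          using fin by (simp add: card_insert_if)
        ultimately show False using max[OF tV] by (simp add: degree_def)
      qed
      then obtain y where y: "y \<in> neighbours E v" "y \<notin> insert t (neighbours E t - {u, v})" by blast
      have "y \<noteq> v" using y edge_in(3)[OF sg] by (auto simp: mem_neighbours)
      moreover have "y \<noteq> u" using y nuv by (auto simp: mem_neighbours)
      ultimately have "{y, t} \<notin> E" "y \<noteq> t" "{y, v} \<in> E" using y by (auto simp: mem_neighbours)
      then show ?thesis using t False by blast
    qed
    then obtain t y where t: "{t, u} \<in> E" and y: "{y, v} \<in> E" "{y, t} \<notin> E" "y \<noteq> t"
      and alt: "y \<in> D \<or> {y, u} \<notin> E \<or> {z, y} \<in> E" by blast
    have vy: "{v, y} \<in> E" "{u, t} \<in> E" using y t by (simp_all add: insert_commute)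
    let ?E = "switch E v y u t"
    note sw = vy nuv(2) y(2) uv[symmetric] y(3)
    show ?thesis
    proof (rule that[of ?E], goal_cases)
      case 1 show ?case by (rule simple_graph_switch[OF sg sw])
    next
      case 2 show ?case by (rule degree_switch[OF sg sw])
    next
      case 3 show ?case
      proof (rule dom')
        show "\<exists>s\<in>insert v (D - {u}). {s, u} \<in> ?E" by (auto simp: mem_switch)
        fix x assume x: "x \<in> V" "x \<notin> D" "x \<noteq> u" "x \<noteq> v"
        have keep: "{s, x} \<in> ?E" if "{s, x} \<in> E" "s \<noteq> u" "s = v \<longrightarrow> x \<noteq> y" for s
          using that x unfolding mem_switch by (auto simp: doubleton_eq_iff)
        obtain s where s: "s \<in> D" "{s, x} \<in> E" using domD[OF x(1,2)] by blast
        show "\<exists>s\<in>insert v (D - {u}). {s, x} \<in> ?E"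
        proof (cases "s = u")
          case False
          moreover have "s \<noteq> v" using s v by blast
          ultimately show ?thesis using keep[OF s(2)] s by blast
        next
          case True
          then have xu: "{x, u} \<in> E" using s by (simp add: insert_commute)
          show ?thesis
          proof (cases "x = y")
            case False
            have "{v, x} \<in> E" using sub[OF xu] by (simp add: insert_commute)
            then show ?thesis using keep[of v] False uv by blast
          next
            case True
            then have "{z, x} \<in> E" using alt x xu by blast
            then show ?thesis using keep[of z] zu zv z by blast
          qed
        qed
      qed
    qed
  qed
qed

text \<open>The vertex brought in is the smallest one outside \<open>D\<close>: by monotonicity it
  has maximal degree there, and being at most \<open>\<gamma>\<close> it has degree no smaller than
  the \<open>u\<close> it replaces.\<close>

lemma dominated_by_top:
  fixes n \<gamma> :: nat and d :: "nat \<Rightarrow> nat"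
  assumes pos: "\<And>i. 1 \<le> i \<Longrightarrow> i \<le> n \<Longrightarrow> 0 < d i"
    and noninc: "\<And>i j. 1 \<le> i \<Longrightarrow> i \<le> j \<Longrightarrow> j \<le> n \<Longrightarrow> d j \<le> d i"
    and "realizes n E d" "dominating_set {1..n} E D" "card D = \<gamma>"
  shows "\<exists>E'. realizes n E' d \<and> dominating_set {1..n} E' {1..\<gamma>}"
  using assms(3-5)
proof (induction "card (D - {1..\<gamma>})" arbitrary: E D rule: less_induct)
  case less
  have sg: "simple_graph {1..n} E" and deg: "\<And>i. i \<in> {1..n} \<Longrightarrow> degree E i = d i"
    using less.prems(1) by (auto simp: realizes_def)
  have DV: "D \<subseteq> {1..n}" using less.prems(2) by (simp add: dominating_set_def)
  then have finD: "finite D" using finite_subset by blast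
  show ?case
  proof (cases "D \<subseteq> {1..\<gamma>}")
    case True
    then have "D = {1..\<gamma>}" using less.prems(3) card_subset_eq[of "{1..\<gamma>}" D] by simp
    then show ?thesis using less.prems by blast
  next
    case False
    then obtain u where u: "u \<in> D" "u \<notin> {1..\<gamma>}" by blast
    have u\<gamma>: "\<gamma> < u" "u \<le> n" using u DV by auto
    have "\<not> {1..\<gamma>} \<subseteq> D"
    proof
      assume "{1..\<gamma>} \<subseteq> D"
      then have "{1..\<gamma>} = D" by (rule card_subset_eq[OF finD]) (simp add: less.prems(3))
      with u show False by blast
    qed
    then obtain v0 where "v0 \<in> {1..\<gamma>}" "v0 \<notin> D" by blast
    then have v0: "v0 \<in> {1..n} - D" "v0 \<le> \<gamma>" using u\<gamma> by auto
    define v where "v = Min ({1..n} - D)"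
    have "v \<in> {1..n} - D" unfolding v_def by (rule Min_in) (use v0 in auto)
    then have v: "v \<in> {1..n}" "v \<notin> D" by auto
    have vmin: "v \<le> t" if "t \<in> {1..n}" "t \<notin> D" for t
      unfolding v_def by (rule Min_le) (use that in auto)
    have v\<gamma>: "v \<le> \<gamma>" using vmin[of v0] v0 by simp
    have uV: "u \<in> {1..n}" using u DV by blast
    obtain E' where E': "simple_graph {1..n} E'" "\<And>x. degree E' x = degree E x"
      "dominating_set {1..n} E' (insert v (D - {u}))"
    proof (rule exchange_dominating[OF sg less.prems(2) u(1) v])
      show "0 < degree E u" using pos[of u] deg[OF uV] uV by simp
      show "degree E u \<le> degree E v"
        using noninc[of v u] deg[OF uV] deg[OF v(1)] v\<gamma> u\<gamma> v by simp
      show "degree E t \<le> degree E v" if "t \<in> {1..n}" "t \<notin> D" for t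
        using noninc[of v t] vmin[OF that] deg[OF that(1)] deg[OF v(1)] v(1) that by simp
    qed (rule that)
    have "insert v (D - {u}) - {1..\<gamma>} = (D - {1..\<gamma>}) - {u}" using v v\<gamma> by auto
    then have "card (insert v (D - {u}) - {1..\<gamma>}) < card (D - {1..\<gamma>})"
      using u finD by (simp add: card_Diff1_less del: card_Diff_insert)
    moreover have "realizes n E' d" using E'(1,2) deg by (simp add: realizes_def)
    moreover have "card D \<ge> 1" using u finD by (simp add: Suc_le_eq card_gt_0_iff) blast
    then have "card (insert v (D - {u})) = \<gamma>" using u v finD less.prems(3) by simp
    ultimately show ?thesis using less.hyps E'(3) by blast
  qed
qed

section \<open>Double counts that yield the three inequalities\<close>

context
  fixes n \<gamma> :: nat and d :: "nat \<Rightarrow> nat" and E :: "nat set set"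
  assumes real: "realizes n E d"
begin

text \<open>Only \<open>card A \<le> k\<close> is asked because in (3) \<open>k\<close> may exceed
  \<open>n - \<gamma>\<close>. The bound \<open>f\<close> is left open since the conditions estimate
  the edges leaving \<open>A\<close> in different ways.\<close>

lemma count_bound:
  fixes k :: nat
  assumes "A \<subseteq> {1..n}" "card A \<le> k" "\<And>v. v \<in> {1..n} - A \<Longrightarrow> int (card (neighbours E v \<inter> A)) \<le> f v"
  shows "(\<Sum>v\<in>A. int (d v)) \<le> int k * (int k - 1) + (\<Sum>v\<in>{1..n}-A. f v)"
proof -
  have sg: "simple_graph {1..n} E" and deg: "\<And>v. v \<in> {1..n} \<Longrightarrow> degree E v = d v"
    using real by (auto simp: realizes_def)
  have finA: "finite A" using assms(1) finite_subset by blast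
  have in_A: "int (card (neighbours E v \<inter> A)) \<le> int k - 1" if "v \<in> A" for v
  proof -
    have "neighbours E v \<inter> A \<subseteq> A - {v}" using neighbours_sub[OF sg] by blast
    then have "card (neighbours E v \<inter> A) \<le> card (A - {v})" using finA by (intro card_mono) auto
    moreover have "card A \<ge> 1" using that finA by (auto simp: Suc_le_eq card_gt_0_iff)
    ultimately show ?thesis using that finA assms(2) by simp
  qed
  have "(\<Sum>v\<in>A. int (d v)) = (\<Sum>v\<in>A. int (degree E v))"
    using deg assms(1) by (intro sum.cong) auto
  also have "\<dots> = int (\<Sum>v\<in>A. degree E v)" by simp
  also have "\<dots> = (\<Sum>v\<in>{1..n}. int (card (neighbours E v \<inter> A)))"
    unfolding sum_degree_eq_V[OF sg assms(1)] by simp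
  also have "\<dots> = (\<Sum>v\<in>A. int (card (neighbours E v \<inter> A)))
      + (\<Sum>v\<in>{1..n}-A. int (card (neighbours E v \<inter> A)))"
    using assms(1) by (simp add: sum.subset_diff add.commute)
  also have "\<dots> \<le> (\<Sum>v\<in>A. int k - 1) + (\<Sum>v\<in>{1..n}-A. f v)"
    using in_A assms(3) by (intro add_mono sum_mono) auto
  also have "(\<Sum>v\<in>A. int k - 1) \<le> int k * (int k - 1)"
    using assms(2) by (cases "k = 0") (auto intro!: mult_right_mono)
  finally show ?thesis by simp
qed

lemma min_card:
  assumes "finite A" "card A \<le> k" "v \<in> {1..n}"
  shows "int (card (neighbours E v \<inter> A)) \<le> min (int k) (int (d v))"
proof -
  have sg: "simple_graph {1..n} E" and deg: "degree E v = d v"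
    using real assms(3) by (auto simp: realizes_def)
  have "card (neighbours E v \<inter> A) \<le> card A" "card (neighbours E v \<inter> A) \<le> degree E v"
    unfolding degree_def using assms(1) finite_neighbours[OF sg] by (intro card_mono; simp)+
  then show ?thesis using assms(2) deg by simp
qed

lemma erdos_gallai_necessary:
  assumes "k \<le> n"
  shows "(\<Sum>i=1..k. int (d i)) \<le> int k * (int k - 1) + (\<Sum>i=k+1..n. min (int k) (int (d i)))"
proof -
  have "{1..n} - {1..k} = {k+1..n}" by auto
  with count_bound[of "{1..k}" k "\<lambda>i. min (int k) (int (d i))"] min_card[of "{1..k}" k] assms
  show ?thesis by simp
qed

context
  assumes dom: "dominating_set {1..n} E {1..\<gamma>}" and gamma: "\<gamma> \<le> n"
begin

lemma dominator: "v \<in> {\<gamma>+1..n} \<Longrightarrow> \<exists>u\<in>{1..\<gamma>}. u \<in> neighbours E v"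
  using dom by (simp add: dominating_set_def)

text \<open>The first form retains the number of dominators instead of using only that there is one;
  in (1) these edges are charged to the degrees of \<open>D\<close>.\<close>

lemma min_card_dominated:
  assumes A: "A \<subseteq> {\<gamma>+1..n}" "card A \<le> k" and v: "v \<in> {\<gamma>+1..n}"
  shows "int (card (neighbours E v \<inter> A)) + 1 \<le> min (int k) (int (d v) - 1) + int (card (neighbours E v \<inter> {1..\<gamma>}))"
    and "int (card (neighbours E v \<inter> A)) \<le> min (int k) (int (d v) - 1)"
proof -
  have sg: "simple_graph {1..n} E" and deg: "degree E v = d v"
    using real v by (auto simp: realizes_def)
  have fin: "finite A" using A finite_subset by blast
  obtain u where u: "u \<in> {1..\<gamma>}" "u \<in> neighbours E v" using dominator[OF v] by blast
  have "neighbours E v \<inter> {1..\<gamma>} \<noteq> {}" using u by blast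
  then have 1: "1 \<le> card (neighbours E v \<inter> {1..\<gamma>})" by (simp add: Suc_le_eq card_gt_0_iff)
  have "card (neighbours E v \<inter> A) + card (neighbours E v \<inter> {1..\<gamma>})
      = card (neighbours E v \<inter> A \<union> neighbours E v \<inter> {1..\<gamma>})"
    using A fin by (subst card_Un_disjoint) auto
  also have "\<dots> \<le> degree E v"
    unfolding degree_def using finite_neighbours[OF sg] by (intro card_mono) auto
  finally have 2: "card (neighbours E v \<inter> A) + card (neighbours E v \<inter> {1..\<gamma>}) \<le> d v" using deg by simp
  have 3: "card (neighbours E v \<inter> A) \<le> k" using card_mono[OF fin, of "neighbours E v \<inter> A"] A by simp
  show "int (card (neighbours E v \<inter> A)) + 1 \<le> min (int k) (int (d v) - 1) + int (card (neighbours E v \<inter> {1..\<gamma>}))"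
    "int (card (neighbours E v \<inter> A)) \<le> min (int k) (int (d v) - 1)"
    using 1 2 3 by linarith+
qed

lemma condition3_necessary:
  "(\<Sum>i=\<gamma>+1..min n (\<gamma>+k). int (d i))
     \<le> int k * (int k - 1) + (\<Sum>i=1..\<gamma>. min (int k) (int (d i)))
       + (\<Sum>i=\<gamma>+k+1..n. min (int k) (int (d i) - 1))"
proof -
  let ?A = "{\<gamma>+1..min n (\<gamma>+k)}"
  let ?f = "\<lambda>i. if i \<le> \<gamma> then min (int k) (int (d i)) else min (int k) (int (d i) - 1)"
  have cA: "card ?A \<le> k" by auto
  have "(\<Sum>v\<in>?A. int (d v)) \<le> int k * (int k - 1) + (\<Sum>v\<in>{1..n}-?A. ?f v)"
    by (rule count_bound) (use cA min_card[of ?A k] min_card_dominated(2)[of ?A k] in auto)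
  also have "{1..n} - ?A = {1..\<gamma>} \<union> {\<gamma>+k+1..n}" using gamma by auto
  also have "(\<Sum>v\<in>{1..\<gamma>} \<union> {\<gamma>+k+1..n}. ?f v) = (\<Sum>v\<in>{1..\<gamma>}. ?f v) + (\<Sum>v\<in>{\<gamma>+k+1..n}. ?f v)"
    by (rule sum.union_disjoint) auto
  finally show ?thesis by simp
qed

text \<open>The edges from \<open>D\<close> to \<open>?A\<close> and to \<open>?T\<close> share the
  degrees of \<open>D\<close>. The term \<open>n - \<gamma>\<close> is made up of \<open>k\<close>
  from the \<open>d - 1\<close> on \<open>?A\<close> and one unit for each vertex of
  \<open>?T\<close>, which has a dominator.\<close>

lemma condition1_necessary:
  assumes k: "k \<le> n - \<gamma>"
  shows "(\<Sum>i=\<gamma>+1..\<gamma>+k. int (d i) - 1)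
         \<le> int k * (int k - 1) - (int n - int \<gamma>) + (\<Sum>i=1..\<gamma>. int (d i))
           + (\<Sum>i=\<gamma>+k+1..n. min (int k) (int (d i) - 1))"
proof -
  let ?A = "{\<gamma>+1..\<gamma>+k}" and ?T = "{\<gamma>+k+1..n}" and ?D = "{1..\<gamma>}"
  let ?N = "\<lambda>v B. card (neighbours E v \<inter> B)"
  have sg: "simple_graph {1..n} E" and deg: "\<And>v. v \<in> {1..n} \<Longrightarrow> degree E v = d v"
    using real by (auto simp: realizes_def)
  have AV: "?A \<subseteq> {1..n}" using k gamma by auto
  have "(\<Sum>v\<in>?A. int (d v)) \<le> int k * (int k - 1) + (\<Sum>v\<in>{1..n}-?A. int (?N v ?A))"
    by (rule count_bound) (use AV in auto)
  also have "{1..n} - ?A = ?D \<union> ?T" using gamma k by auto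
  also have "(\<Sum>v\<in>?D \<union> ?T. int (?N v ?A)) = (\<Sum>v\<in>?D. int (?N v ?A)) + (\<Sum>v\<in>?T. int (?N v ?A))"
    by (rule sum.union_disjoint) auto
  finally have 1: "(\<Sum>v\<in>?A. int (d v)) \<le> int k * (int k - 1)
      + ((\<Sum>v\<in>?D. int (?N v ?A)) + (\<Sum>v\<in>?T. int (?N v ?A)))" .
  have "(\<Sum>v\<in>?T. int (?N v ?A) + 1) \<le> (\<Sum>v\<in>?T. min (int k) (int (d v) - 1) + int (?N v ?D))"
    using min_card_dominated(1)[of ?A k] k gamma by (intro sum_mono) auto
  then have 2: "(\<Sum>v\<in>?T. int (?N v ?A)) + (int n - int \<gamma> - int k)
      \<le> (\<Sum>v\<in>?T. min (int k) (int (d v) - 1)) + (\<Sum>v\<in>?T. int (?N v ?D))"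
    using k gamma by (simp add: sum.distrib of_nat_diff)
  have "(\<Sum>v\<in>?T. ?N v ?D) = (\<Sum>v\<in>?D. ?N v ?T)"
    by (rule sum_degree_eq[OF sg]) (use gamma in auto)
  then have 3: "(\<Sum>v\<in>?T. int (?N v ?D)) = (\<Sum>v\<in>?D. int (?N v ?T))"
    by (simp flip: of_nat_sum)
  have "?N v ?A + ?N v ?T \<le> d v" if "v \<in> ?D" for v
  proof -
    have "?N v ?A + ?N v ?T = card (neighbours E v \<inter> ?A \<union> neighbours E v \<inter> ?T)"
      by (subst card_Un_disjoint) auto
    also have "\<dots> \<le> degree E v"
      unfolding degree_def using finite_neighbours[OF sg] by (intro card_mono) auto
    finally show ?thesis using deg[of v] that gamma by simp
  qed
  then have "(\<Sum>v\<in>?D. int (?N v ?A) + int (?N v ?T)) \<le> (\<Sum>v\<in>?D. int (d v))"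
    by (intro sum_mono) fastforce
  then have 4: "(\<Sum>v\<in>?D. int (?N v ?A)) + (\<Sum>v\<in>?D. int (?N v ?T)) \<le> (\<Sum>v\<in>?D. int (d v))"
    by (simp add: sum.distrib)
  have 5: "(\<Sum>v\<in>?A. int (d v) - 1) = (\<Sum>v\<in>?A. int (d v)) - int k" by (simp add: sum_subtractf)
  show ?thesis unfolding 5 using 1 2 3 4 by linarith
qed

end

end

text \<open>Parity does not follow from the inequalities: three ones with
  \<open>\<gamma> = 3\<close> satisfy all of them. In (3) \<open>k\<close> can exceed
  \<open>n - \<gamma>\<close>, so the sum on the left is cut at \<open>n\<close>.\<close>

theorem theorem2:
  fixes n \<gamma> :: nat and d :: "nat \<Rightarrow> nat"
  assumes pos: "\<forall>i\<in>{1..n}. d i > 0"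
    and noninc: "\<forall>i\<in>{1..n}. \<forall>j\<in>{1..n}. i \<le> j \<longrightarrow> d j \<le> d i"
    and gamma: "\<gamma> \<in> {1..n}"
  shows "(\<exists>E D. realizes n E d \<and> dominating_set {1..n} E D \<and> card D = \<gamma>) \<longleftrightarrow>
    even (\<Sum>i=1..n. d i) \<and>
    (\<forall>k\<in>{0..n - \<gamma>}.
       (\<Sum>i=\<gamma>+1..\<gamma>+k. int (d i) - 1)
         \<le> int k * (int k - 1) - (int n - int \<gamma>) + (\<Sum>i=1..\<gamma>. int (d i))
           + (\<Sum>i=\<gamma>+k+1..n. min (int k) (int (d i) - 1))) \<and>
    (\<forall>k\<in>{0..n}.
       (\<Sum>i=1..k. int (d i))
         \<le> int k * (int k - 1) + (\<Sum>i=k+1..n. min (int k) (int (d i)))) \<and>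
    (\<forall>k\<in>{0..d 1}.
       (\<Sum>i=\<gamma>+1..min n (\<gamma>+k). int (d i))
         \<le> int k * (int k - 1) + (\<Sum>i=1..\<gamma>. min (int k) (int (d i)))
           + (\<Sum>i=\<gamma>+k+1..n. min (int k) (int (d i) - 1)))"
proof -
  have \<gamma>: "\<gamma> \<le> n" and pos': "\<And>i. 1 \<le> i \<Longrightarrow> i \<le> n \<Longrightarrow> 0 < d i"
    and noninc': "\<And>i j. 1 \<le> i \<Longrightarrow> i \<le> j \<Longrightarrow> j \<le> n \<Longrightarrow> d j \<le> d i"
    using gamma pos noninc by auto
  show ?thesis
  proof (rule iffI, goal_cases)
    case 1
    then obtain E0 D where "realizes n E0 d" "dominating_set {1..n} E0 D" "card D = \<gamma>" by blast
    from dominated_by_top[OF pos' noninc' this] obtain E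
      where E: "realizes n E d" and dom: "dominating_set {1..n} E {1..\<gamma>}" by blast
    have "(\<Sum>i=1..n. d i) = (\<Sum>i=1..n. degree E i)"
      using E by (intro sum.cong) (auto simp: realizes_def)
    moreover have "simple_graph {1..n} E" using E by (simp add: realizes_def)
    ultimately have "even (\<Sum>i=1..n. d i)" using even_sum_degree by metis
    then show ?case
      using condition1_necessary[OF E dom \<gamma>] erdos_gallai_necessary[OF E]
        condition3_necessary[OF E dom \<gamma>] by (intro conjI ballI) simp_all
  next
    case rhs: 2
    have EG: "(\<Sum>i=0+1..r. d i) \<le> (r - 0) * (r - 0 - 1) + (\<Sum>i=r+1..n. min (r - 0) (d i))"
      if r: "0 < r" "r \<le> n" for r
    proof -
      have "(\<Sum>i=1..r. int (d i)) \<le> int r * (int r - 1) + (\<Sum>i=r+1..n. min (int r) (int (d i)))"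
        using rhs r by simp
      moreover have "int r * (int r - 1) = int (r * (r - 1))" using r by (simp add: of_nat_diff)
      moreover have "(\<Sum>i=r+1..n. min (int r) (int (d i))) = int (\<Sum>i=r+1..n. min r (d i))"
        by (simp add: of_nat_min)
      moreover have "(\<Sum>i=1..r. int (d i)) = int (\<Sum>i=1..r. d i)" by simp
      ultimately have "int (\<Sum>i=1..r. d i) \<le> int (r * (r - 1) + (\<Sum>i=r+1..n. min r (d i)))"
        unfolding of_nat_add by linarith
      then show ?thesis unfolding of_nat_le_iff by simp
    qed
    obtain E where E: "simple_graph {0+1..n} E" "\<And>v. v \<in> {0+1..n} \<Longrightarrow> degree E v = d v"
    proof (rule Erdos_Gallai[of 0 n d])
      show "even (\<Sum>i=0+1..n. d i)" using rhs by simp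
      show "d j \<le> d i" if "0 < i" "i \<le> j" "j \<le> n" for i j using noninc'[of i j] that by simp
    qed (use EG in auto)
    interpret domination_conditions n \<gamma> d
      by unfold_locales (use \<gamma> pos' noninc' rhs in auto)
    have "realizes n E d" using E by (simp add: realizes_def)
    then obtain F where F: "realizes n F d" "undominated \<gamma> n F = {}"
      using dominated_realization rhs by force
    have "\<exists>u\<in>{1..\<gamma>}. u \<in> neighbours F v" if "v \<in> {1..n} - {1..\<gamma>}" for v
    proof -
      have "v \<notin> undominated \<gamma> n F" using F by simp
      then show ?thesis using that by (auto simp: undominated_def mem_neighbours)
    qed
    then have "dominating_set {1..n} F {1..\<gamma>}" using \<gamma> by (auto simp: dominating_set_def)
    then show ?case using F(1) by (metis card_atLeastAtMost diff_Suc_1)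
  qed
qed

end
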